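(* Let $\{f_t:t\in\mathbb{N}\}$ be a countably infinite set of scaling functions totally ordered by domination. For each $t\in\mathbb{N}$ let $\Xi_t$ be any scale limit. Let $\Gamma$ be any permuton and $\Lambda$ any permutation local limit. Then there exists a sequence of permutations $(\tau_m)_{m\in\mathbb{N}}$ with $|\tau_m|\to\infty$ which converges to $\Xi_t$ at scale $f_t$ for every $t\in\mathbb{N}$, converges globally to $\Gamma$, and converges locally to $\Lambda$.
   Context: For $g,h:\mathbb{N}\to\mathbb{R}^+$ write $g\ll h$ if $g(n)/h(n)\to0$. A scaling function is a function $f:\mathbb{N}\to\mathbb{R}^+$ with $f(n)\le n$ for all $n$, $f(n)\to\infty$ and $f(n)/n\to 0$. A set of scaling functions is totally ordered by domination if for every two distinct members $f,g$ either $f\ll g$ or $g\ll f$. Let $S_n$ be the set of permutations of $[n]$ and $S=\bigcup_nS_n$. An occurrence of $\pi\in S_k$ in $\sigma\in S_n$ is a set of indices $i_1<\dots<i_k$ with $\sigma(i_1)\dots\sigma(i_k)$ order-isomorphic to $\pi$; its width is $i_k-i_1+1$. For real $f\in[k,n]$, $\rho_f(\pi,\sigma)$ is the number of occurrences of $\pi$ in $\sigma$ of width at most $f$ divided by the number of $k$-subsets of $[n]$ of width at most $f$; the global density is $\rho(\pi,\sigma)=\rho_n(\pi,\sigma)$ and the local density is $\rho_k(\pi,\sigma)$ (consecutive occurrences). A sequence $(\sigma_j)$ with $|\sigma_j|\to\infty$ converges at scale $f$ to $\Xi\in[0,1]^S$ if $\rho_{f(|\sigma_j|)}(\pi,\sigma_j)\to\Xi_\pi$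 for all $\pi\in S$; a scale limit is a $\Xi$ arising in this way for some scaling function and some sequence. The sequence converges locally to $\Lambda\in[0,1]^S$ if $\rho_{|\pi|}(\pi,\sigma_j)\to\Lambda_\pi$ for all $\pi$; a permutation local limit is a $\Lambda$ arising in this way. A permuton is a Borel probability measure $\Gamma$ on $[0,1]^2$ with uniform marginals; $\rho(\pi,\Gamma)$ is the probability that $k=|\pi|$ independent $\Gamma$-distributed points, listed in increasing order of $x$-coordinate, have $y$-coordinates order-isomorphic to $\pi$. The sequence converges globally to $\Gamma$ if $\rho(\pi,\sigma_j)\to\rho(\pi,\Gamma)$ for all $\pi$. *)

theory Defs
  imports "HOL-Probability.Probability"
begin

text \<open>Permutations of [n] are represented as lists over {0..<n} (0-based):
  a permutation sigma of length n is a list whose entries are exactly 0,...,n-1.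
  S is the set of all nonempty permutations (n >= 1).\<close>

definition is_perm :: "nat list \<Rightarrow> bool" where
  "is_perm \<sigma> \<longleftrightarrow> distinct \<sigma> \<and> set \<sigma> = {0..<length \<sigma>}"

definition PermS :: "nat list set" where
  "PermS = {\<pi>. is_perm \<pi> \<and> length \<pi> \<ge> 1}"

definition std :: "nat list \<Rightarrow> nat list" where
  "std vs = map (\<lambda>v. card {w \<in> set vs. w < v}) vs"

definition pat_at :: "nat list \<Rightarrow> nat set \<Rightarrow> nat list" where
  "pat_at \<sigma> I = std (map (\<lambda>i. \<sigma> ! i) (sorted_list_of_set I))"

definition width :: "nat set \<Rightarrow> nat" where
  "width I = Max I - Min I + 1"

definition windows :: "real \<Rightarrow> nat \<Rightarrow> nat \<Rightarrow> nat set set" where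
  "windows f k n = {I. I \<subseteq> {0..<n} \<and> card I = k \<and> real (width I) \<le> f}"

definition rho :: "real \<Rightarrow> nat list \<Rightarrow> nat list \<Rightarrow> real" where
  "rho f \<pi> \<sigma> =
     real (card {I \<in> windows f (length \<pi>) (length \<sigma>). pat_at \<sigma> I = \<pi>})
     / real (card (windows f (length \<pi>) (length \<sigma>)))"

definition global_density :: "nat list \<Rightarrow> nat list \<Rightarrow> real" where
  "global_density \<pi> \<sigma> = rho (real (length \<sigma>)) \<pi> \<sigma>"

definition local_density :: "nat list \<Rightarrow> nat list \<Rightarrow> real" where
  "local_density \<pi> \<sigma> = rho (real (length \<pi>)) \<pi> \<sigma>"

definition dominated :: "(nat \<Rightarrow> real) \<Rightarrow> (nat \<Rightarrow> real) \<Rightarrow> bool" where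
  "dominated g h \<longleftrightarrow> ((\<lambda>n. g n / h n) \<longlonglongrightarrow> 0)"

text \<open>Scaling functions; the natural numbers start at 1 here (f(n) <= n with f(n) > 0).\<close>
definition scaling_function :: "(nat \<Rightarrow> real) \<Rightarrow> bool" where
  "scaling_function f \<longleftrightarrow>
     (\<forall>n\<ge>1. 0 < f n \<and> f n \<le> real n) \<and>
     filterlim f at_top sequentially \<and>
     ((\<lambda>n. f n / real n) \<longlonglongrightarrow> 0)"

definition perm_sequence :: "(nat \<Rightarrow> nat list) \<Rightarrow> bool" where
  "perm_sequence \<sigma> \<longleftrightarrow> (\<forall>j. is_perm (\<sigma> j)) \<and>
     filterlim (\<lambda>j. length (\<sigma> j)) at_top sequentially"

definition converges_at_scale ::
    "(nat \<Rightarrow> real) \<Rightarrow> (nat \<Rightarrow> nat list) \<Rightarrow> (nat list \<Rightarrow> real) \<Rightarrow> bool" where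
  "converges_at_scale f \<sigma> \<Xi> \<longleftrightarrow>
     (\<forall>\<pi>\<in>PermS. (\<lambda>j. rho (f (length (\<sigma> j))) \<pi> (\<sigma> j)) \<longlonglongrightarrow> \<Xi> \<pi>)"

definition scale_limit :: "(nat list \<Rightarrow> real) \<Rightarrow> bool" where
  "scale_limit \<Xi> \<longleftrightarrow>
     (\<exists>f \<sigma>. scaling_function f \<and> perm_sequence \<sigma> \<and> converges_at_scale f \<sigma> \<Xi>)"

definition converges_locally :: "(nat \<Rightarrow> nat list) \<Rightarrow> (nat list \<Rightarrow> real) \<Rightarrow> bool" where
  "converges_locally \<sigma> \<Lambda> \<longleftrightarrow>
     (\<forall>\<pi>\<in>PermS. (\<lambda>j. local_density \<pi> (\<sigma> j)) \<longlonglongrightarrow> \<Lambda> \<pi>)"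

definition perm_local_limit :: "(nat list \<Rightarrow> real) \<Rightarrow> bool" where
  "perm_local_limit \<Lambda> \<longleftrightarrow> (\<exists>\<sigma>. perm_sequence \<sigma> \<and> converges_locally \<sigma> \<Lambda>)"

text \<open>Permutons: Borel probability measures on the plane with uniform marginals on [0,1]
  (hence concentrated on the unit square).\<close>
definition permuton :: "(real \<times> real) measure \<Rightarrow> bool" where
  "permuton \<Gamma> \<longleftrightarrow> prob_space \<Gamma> \<and> sets \<Gamma> = sets borel \<and>
     distr \<Gamma> borel fst = uniform_measure lborel {0..1} \<and>
     distr \<Gamma> borel snd = uniform_measure lborel {0..1}"

text \<open>The event that k points p 0,...,p (k-1), listed in increasing order of x-coordinate
  (via the reordering s), have y-coordinates order-isomorphic to pi.  Ties in x have
  probability zero and are excluded.\<close>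
definition pattern_event :: "nat list \<Rightarrow> (nat \<Rightarrow> real \<times> real) set" where
  "pattern_event \<pi> = {p. \<exists>s. (\<forall>a<length \<pi>. s a < length \<pi>) \<and>
      (\<forall>a<length \<pi>. \<forall>b<length \<pi>.
         (a < b \<longrightarrow> fst (p (s a)) < fst (p (s b))) \<and>
         (snd (p (s a)) < snd (p (s b)) \<longleftrightarrow> \<pi> ! a < \<pi> ! b))}"

definition permuton_density :: "nat list \<Rightarrow> (real \<times> real) measure \<Rightarrow> real" where
  "permuton_density \<pi> \<Gamma> =
     measure (PiM {0..<length \<pi>} (\<lambda>_. \<Gamma>))
       (pattern_event \<pi> \<inter> space (PiM {0..<length \<pi>} (\<lambda>_. \<Gamma>)))"

definition converges_globally :: "(nat \<Rightarrow> nat list) \<Rightarrow> (real \<times> real) measure \<Rightarrow> bool" where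
  "converges_globally \<sigma> \<Gamma> \<longleftrightarrow>
     (\<forall>\<pi>\<in>PermS. (\<lambda>j. global_density \<pi> (\<sigma> j)) \<longlonglongrightarrow> permuton_density \<pi> \<Gamma>)"

end

theory Submission
  imports Defs "HOL-Library.List_Lexorder"
begin

text \<open>
  A permutation of length \<open>n\<close> is built from finitely many levels, one for each scale, by comparing
  positions lexicographically, coarse levels first. A level of scale \<open>F\<close>, whose target is
  approximated by the density at scale \<open>w\<close> in a fixed permutation \<open>\<sigma>\<close>, cuts the positions into
  blocks of length about \<open>F n / w\<close> and orders the blocks like an infinite direct sum of copies of
  \<open>\<sigma>\<close>. A typical window of width at most \<open>F n\<close> crosses no block boundary of any coarser level, so
  all coarser levels are tied on it; it meets every block of its own level at most once, so the
  finer levels are irrelevant; and its blocks lie inside a single copy of \<open>\<sigma>\<close>. Hence its pattern is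
  distributed almost like that of a window of width \<open>w\<close> in \<open>\<sigma>\<close>. The local limit is the level of
  scale \<open>1\<close>, and the permuton is the level of scale \<open>n\<close>, for which \<open>\<sigma>\<close> is obtained by sampling
  points and bounding the second moment of the pattern densities. A diagonal choice over more and
  more levels and patterns gives the sequence.
\<close>

subsection \<open>Patterns\<close>

definition rank_on :: "('b \<Rightarrow> 'a::linorder) \<Rightarrow> 'b set \<Rightarrow> 'b \<Rightarrow> nat" where
  "rank_on u A x = card {y \<in> A. u y < u x}"

lemma rank_on_less_iff:
  assumes "finite A" "x \<in> A" "y \<in> A"
  shows "rank_on u A x < rank_on u A y \<longleftrightarrow> u x < u y"
proof -
  have less: "rank_on u A a < rank_on u A b" if "a \<in> A" "u a < u b" for a b
    unfolding rank_on_def using assms(1) that by (intro psubset_card_mono) auto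
  have "rank_on u A x = rank_on u A y" if "u x = u y"
    using that by (simp add: rank_on_def)
  then show ?thesis
    using less[of x y] less[of y x] assms by (cases "u x" "u y" rule: linorder_cases) auto
qed

lemma bij_betw_rank_on:
  assumes "finite A" "inj_on u A"
  shows "bij_betw (rank_on u A) A {0..<card A}"
proof -
  have "inj_on (rank_on u A) A"
  proof (rule inj_onI)
    fix x y assume xy: "x \<in> A" "y \<in> A" "rank_on u A x = rank_on u A y"
    then have "u x = u y"
      using rank_on_less_iff[OF assms(1), of x y u] rank_on_less_iff[OF assms(1), of y x u]
      by (metis less_irrefl linorder_less_linear)
    then show "x = y" using assms(2) xy by (auto dest: inj_onD)
  qed
  moreover have "rank_on u A ` A \<subseteq> {0..<card A}"
    unfolding rank_on_def using assms(1) by (auto intro!: psubset_card_mono)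
  ultimately show ?thesis
    by (metis assms(1) bij_betw_def card_atLeastLessThan card_image card_subset_eq diff_zero
        finite_atLeastLessThan)
qed

definition pattern_on :: "(nat \<Rightarrow> 'a::linorder) \<Rightarrow> nat set \<Rightarrow> nat list" where
  "pattern_on u I = map (rank_on u I) (sorted_list_of_set I)"

lemma pat_at_eq_pattern_on:
  assumes "inj_on ((!) \<sigma>) I"
  shows "pat_at \<sigma> I = pattern_on ((!) \<sigma>) I"
proof (cases "finite I")
  case True
  have "card {w \<in> (!) \<sigma> ` I. w < \<sigma> ! i} = card {j \<in> I. \<sigma> ! j < \<sigma> ! i}" for i
  proof -
    have "{w \<in> (!) \<sigma> ` I. w < \<sigma> ! i} = (!) \<sigma> ` {j \<in> I. \<sigma> ! j < \<sigma> ! i}" by auto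
    then show ?thesis using inj_on_subset[OF assms] by (simp add: card_image)
  qed
  then show ?thesis
    using True by (simp add: pat_at_def std_def pattern_on_def rank_on_def)
qed (simp add: pat_at_def std_def pattern_on_def)

lemma is_perm_pattern_on:
  assumes "finite I" "inj_on u I"
  shows "is_perm (pattern_on u I)"
  using bij_betw_rank_on[OF assms] assms(1)
  by (simp add: is_perm_def pattern_on_def distinct_map bij_betw_def)

lemma length_pattern_on [simp]: "length (pattern_on u I) = card I"
  by (simp add: pattern_on_def)

lemma pattern_on_cong:
  assumes "\<And>i j. i \<in> I \<Longrightarrow> j \<in> I \<Longrightarrow> u i < u j \<longleftrightarrow> v i < v j"
  shows "pattern_on u I = pattern_on v I"
proof (cases "finite I")
  case True
  then show ?thesis
    using assms by (auto simp: pattern_on_def rank_on_def intro!: arg_cong[of _ _ card])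
qed (simp add: pattern_on_def)

lemma sorted_list_of_set_image:
  assumes "finite B" "strict_mono_on B h"
  shows "sorted_list_of_set (h ` B) = map h (sorted_list_of_set B)"
proof (rule sorted_distinct_set_unique)
  show "sorted (map h (sorted_list_of_set B))"
    unfolding sorted_map
    by (rule sorted_wrt_mono_rel[OF _ sorted_sorted_list_of_set[of B]])
      (use assms in \<open>auto simp: strict_mono_on_leD\<close>)
  show "distinct (map h (sorted_list_of_set B))"
    using assms by (simp add: distinct_map strict_mono_on_imp_inj_on)
qed (use assms in auto)

lemma pattern_on_image:
  assumes "finite B" "strict_mono_on B h"
  shows "pattern_on u (h ` B) = pattern_on (u \<circ> h) B"
proof -
  have "rank_on u (h ` B) (h b) = rank_on (u \<circ> h) B b" for b
  proof -
    have "{y \<in> h ` B. u y < u (h b)} = h ` {c \<in> B. u (h c) < u (h b)}" by auto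
    then show ?thesis
      using inj_on_subset[OF strict_mono_on_imp_inj_on[OF assms(2)]]
      by (simp add: rank_on_def card_image)
  qed
  then show ?thesis by (simp add: pattern_on_def sorted_list_of_set_image[OF assms])
qed

lemma nth_pattern_on_interval: "i < n \<Longrightarrow> pattern_on u {0..<n} ! i = rank_on u {0..<n} i"
  by (simp add: pattern_on_def)

lemma is_perm_inj_on_nth: "is_perm \<sigma> \<Longrightarrow> I \<subseteq> {0..<length \<sigma>} \<Longrightarrow> inj_on ((!) \<sigma>) I"
  by (intro inj_on_nth) (auto simp: is_perm_def)

lemma is_perm_nth_less: "is_perm \<sigma> \<Longrightarrow> i < length \<sigma> \<Longrightarrow> \<sigma> ! i < length \<sigma>"
  unfolding is_perm_def by (metis atLeastLessThan_iff nth_mem)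

lemma pattern_on_perm:
  assumes "is_perm \<pi>"
  shows "pattern_on ((!) \<pi>) {0..<length \<pi>} = \<pi>"
proof (rule nth_equalityI)
  fix i assume "i < length (pattern_on ((!) \<pi>) {0..<length \<pi>})"
  then have i: "i < length \<pi>" by simp
  have "(!) \<pi> ` {j \<in> {0..<length \<pi>}. \<pi> ! j < \<pi> ! i} = {w \<in> set \<pi>. w < \<pi> ! i}"
    by (auto simp: in_set_conv_nth)
  also have "\<dots> = {0..<\<pi> ! i}"
    using assms is_perm_nth_less[OF assms i] by (auto simp: is_perm_def)
  finally have "card ((!) \<pi> ` {j \<in> {0..<length \<pi>}. \<pi> ! j < \<pi> ! i}) = \<pi> ! i" by simp
  moreover have "inj_on ((!) \<pi>) {j \<in> {0..<length \<pi>}. \<pi> ! j < \<pi> ! i}"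
    using assms by (intro is_perm_inj_on_nth) auto
  ultimately have "rank_on ((!) \<pi>) {0..<length \<pi>} i = \<pi> ! i"
    by (simp add: rank_on_def card_image)
  then show "pattern_on ((!) \<pi>) {0..<length \<pi>} ! i = \<pi> ! i"
    using i by (simp add: nth_pattern_on_interval)
qed simp

lemma pat_at_pattern_on:
  assumes "inj_on u {0..<n}" "I \<subseteq> {0..<n}"
  shows "pat_at (pattern_on u {0..<n}) I = pattern_on u I"
proof -
  have "inj_on ((!) (pattern_on u {0..<n})) I"
    using assms by (intro is_perm_inj_on_nth is_perm_pattern_on) auto
  then have "pat_at (pattern_on u {0..<n}) I = pattern_on ((!) (pattern_on u {0..<n})) I"
    by (rule pat_at_eq_pattern_on)
  also have "\<dots> = pattern_on u I"
  proof (rule pattern_on_cong)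
    fix i j assume "i \<in> I" "j \<in> I"
    then have "i \<in> {0..<n}" "j \<in> {0..<n}" using assms(2) by auto
    then show "pattern_on u {0..<n} ! i < pattern_on u {0..<n} ! j \<longleftrightarrow> u i < u j"
      using rank_on_less_iff[of "{0..<n}" i j u] by (simp add: nth_pattern_on_interval)
  qed
  finally show ?thesis .
qed

lemma pattern_on_eq_iff:
  assumes \<pi>: "is_perm \<pi>" and I: "finite I" "card I = length \<pi>"
  defines "xs \<equiv> sorted_list_of_set I"
  shows "pattern_on u I = \<pi> \<longleftrightarrow>
    (\<forall>a<length \<pi>. \<forall>b<length \<pi>. u (xs ! a) < u (xs ! b) \<longleftrightarrow> \<pi> ! a < \<pi> ! b)"
proof
  assume pattern: "pattern_on u I = \<pi>"
  have "\<pi> ! a = rank_on u I (xs ! a)" if "a < length \<pi>" for a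
    unfolding pattern[symmetric] using that I(2) by (simp add: pattern_on_def xs_def)
  moreover have "xs ! a \<in> I" if "a < length \<pi>" for a
    using that I nth_mem[of a xs] by (simp add: xs_def)
  ultimately show "\<forall>a<length \<pi>. \<forall>b<length \<pi>. u (xs ! a) < u (xs ! b) \<longleftrightarrow> \<pi> ! a < \<pi> ! b"
    by (auto simp: rank_on_less_iff[OF I(1)])
next
  assume order: "\<forall>a<length \<pi>. \<forall>b<length \<pi>. u (xs ! a) < u (xs ! b) \<longleftrightarrow> \<pi> ! a < \<pi> ! b"
  have "I = (!) xs ` {0..<length \<pi>}"
    using I nth_image[of "length \<pi>" xs] by (simp add: xs_def)
  moreover have "strict_mono_on {0..<length \<pi>} ((!) xs)"
    using I by (auto simp: strict_mono_on_def xs_def intro: sorted_wrt_nth_less)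
  ultimately have "pattern_on u I = pattern_on (u \<circ> (!) xs) {0..<length \<pi>}"
    by (simp add: pattern_on_image)
  also have "\<dots> = pattern_on ((!) \<pi>) {0..<length \<pi>}"
    using order by (intro pattern_on_cong) simp
  finally show "pattern_on u I = \<pi>" using pattern_on_perm[OF \<pi>] by simp
qed

subsection \<open>Windows\<close>

lemma finite_windows [simp, intro]: "finite (windows f k n)"
  by (rule finite_subset[of _ "Pow {0..<n}"]) (auto simp: windows_def)

lemma windowsD:
  assumes "I \<in> windows f k n" "1 \<le> k"
  shows "finite I" "I \<noteq> {}" "I \<subseteq> {0..<n}" "card I = k" "Min I \<le> Max I" "Max I < n"
    "Max I - Min I + 1 \<le> nat \<lfloor>f\<rfloor>"
proof -
  show "I \<subseteq> {0..<n}" "card I = k" using assms(1) by (auto simp: windows_def)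
  then show "finite I" "I \<noteq> {}" using assms(2) finite_subset by fastforce+
  then show "Min I \<le> Max I" "Max I < n" using \<open>I \<subseteq> {0..<n}\<close> by (auto simp: subset_iff)
  show "Max I - Min I + 1 \<le> nat \<lfloor>f\<rfloor>"
    using assms(1) by (intro le_nat_floor) (simp add: windows_def width_def)
qed

lemma card_subsets_containing:
  assumes "finite A" "i \<in> A" "1 \<le> k"
  shows "card {T \<in> Pow A. card T = k \<and> i \<in> T} = (card A - 1) choose (k - 1)"
proof -
  have "{T \<in> Pow A. card T = k \<and> i \<in> T} = insert i ` {T. T \<subseteq> A - {i} \<and> card T = k - 1}"
  proof (intro equalityI subsetI)
    fix T assume T: "T \<in> {T \<in> Pow A. card T = k \<and> i \<in> T}"
    then have "T - {i} \<subseteq> A - {i}" "card (T - {i}) = k - 1" "T = insert i (T - {i})" by auto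
    then show "T \<in> insert i ` {T. T \<subseteq> A - {i} \<and> card T = k - 1}" by blast
  next
    fix T assume "T \<in> insert i ` {T. T \<subseteq> A - {i} \<and> card T = k - 1}"
    then obtain T' where T': "T' \<subseteq> A - {i}" "card T' = k - 1" "T = insert i T'" by blast
    moreover have "finite T'" "i \<notin> T'" using T'(1) assms(1) finite_subset by auto
    ultimately show "T \<in> {T \<in> Pow A. card T = k \<and> i \<in> T}" using assms by auto
  qed
  moreover have "inj_on (insert i) {T. T \<subseteq> A - {i} \<and> card T = k - 1}"
  proof (rule inj_onI)
    fix T U assume "T \<in> {T. T \<subseteq> A - {i} \<and> card T = k - 1}" "U \<in> {T. T \<subseteq> A - {i} \<and> card T = k - 1}"
    then have "i \<notin> T" "i \<notin> U" by auto
    then show "insert i T = insert i U \<Longrightarrow> T = U" by (simp add: insert_ident)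
  qed
  ultimately show ?thesis using assms by (simp add: card_image n_subsets)
qed

lemma windows_with_Min:
  assumes "1 \<le> k" "1 \<le> f" "i < n"
  shows "{I \<in> windows f k n. Min I = i} =
    {I \<in> Pow {i..<i + min (nat \<lfloor>f\<rfloor>) (n - i)}. card I = k \<and> i \<in> I}"
proof (intro set_eqI iffI)
  fix I assume "I \<in> {I \<in> windows f k n. Min I = i}"
  then have I: "I \<in> windows f k n" "Min I = i" by auto
  note window = windowsD[OF I(1) assms(1)]
  have "j \<in> {i..<i + min (nat \<lfloor>f\<rfloor>) (n - i)}" if "j \<in> I" for j
  proof -
    have "i \<le> j" "j \<le> Max I" using window(1) I(2) that by auto
    then show ?thesis using window(5-7) I(2) assms(3) by auto
  qed
  then show "I \<in> {I \<in> Pow {i..<i + min (nat \<lfloor>f\<rfloor>) (n - i)}. card I = k \<and> i \<in> I}"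
    using Min_in[OF window(1,2)] window(4) I(2) by auto
next
  fix I assume "I \<in> {I \<in> Pow {i..<i + min (nat \<lfloor>f\<rfloor>) (n - i)}. card I = k \<and> i \<in> I}"
  then have I: "I \<subseteq> {i..<i + min (nat \<lfloor>f\<rfloor>) (n - i)}" "card I = k" "i \<in> I" by auto
  then have fin: "finite I" using finite_subset by blast
  have Min: "Min I = i" using I fin by (intro Min_eqI) auto
  have "Max I \<in> {i..<i + min (nat \<lfloor>f\<rfloor>) (n - i)}" using fin I(1,3) Max_in[of I] by blast
  then have "i \<le> Max I" "Max I < i + nat \<lfloor>f\<rfloor>" by auto
  then have "width I \<le> nat \<lfloor>f\<rfloor>" unfolding width_def Min by linarith
  then have "real (width I) \<le> f" using assms(2) by linarith
  moreover have "{i..<i + min (nat \<lfloor>f\<rfloor>) (n - i)} \<subseteq> {0..<n}" using assms(3) by auto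
  then have "I \<subseteq> {0..<n}" using I(1) by blast
  ultimately show "I \<in> {I \<in> windows f k n. Min I = i}" using I(2) Min by (simp add: windows_def)
qed

lemma card_windows_with_Min:
  assumes "1 \<le> k" "1 \<le> f" "i < n"
  shows "card {I \<in> windows f k n. Min I = i} = (min (nat \<lfloor>f\<rfloor>) (n - i) - 1) choose (k - 1)"
proof -
  have "0 < nat \<lfloor>f\<rfloor>" using assms(2) by linarith
  then show ?thesis
    unfolding windows_with_Min[OF assms] using assms by (subst card_subsets_containing) auto
qed

lemma card_windows_Min_in:
  assumes "1 \<le> k" "1 \<le> f" "A \<subseteq> {0..<n}"
  shows "card {I \<in> windows f k n. Min I \<in> A} = (\<Sum>i\<in>A. (min (nat \<lfloor>f\<rfloor>) (n - i) - 1) choose (k - 1))"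
proof -
  have "{I \<in> windows f k n. Min I \<in> A} = (\<Union>i\<in>A. {I \<in> windows f k n. Min I = i})" by auto
  also have "card \<dots> = (\<Sum>i\<in>A. card {I \<in> windows f k n. Min I = i})"
    using assms(3) by (intro card_UN_disjoint) (auto intro: finite_subset)
  finally show ?thesis
    using assms by (simp add: card_windows_with_Min subset_iff)
qed

lemma card_windows_Min_in_le:
  assumes "1 \<le> k" "1 \<le> f" "A \<subseteq> {0..<n}"
  shows "card {I \<in> windows f k n. Min I \<in> A} \<le> card A * ((nat \<lfloor>f\<rfloor> - 1) choose (k - 1))"
proof -
  have "(min (nat \<lfloor>f\<rfloor>) (n - i) - 1) choose (k - 1) \<le> (nat \<lfloor>f\<rfloor> - 1) choose (k - 1)" for i
    by (intro binomial_right_mono diff_le_mono) (rule min.cobounded1)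
  then show ?thesis
    unfolding card_windows_Min_in[OF assms] by (metis (no_types, lifting) of_nat_id sum_bounded_above)
qed

lemma card_windows_le:
  assumes "1 \<le> k" "1 \<le> f"
  shows "card (windows f k n) \<le> n * ((nat \<lfloor>f\<rfloor> - 1) choose (k - 1))"
proof -
  have "windows f k n = {I \<in> windows f k n. Min I \<in> {0..<n}}"
    using windowsD(5,6)[OF _ assms(1)] by fastforce
  also have "card \<dots> \<le> card {0..<n} * ((nat \<lfloor>f\<rfloor> - 1) choose (k - 1))"
    by (rule card_windows_Min_in_le[OF assms order_refl])
  finally show ?thesis by simp
qed

lemma card_windows_ge:
  assumes "1 \<le> k" "1 \<le> f" "nat \<lfloor>f\<rfloor> \<le> n"
  shows "(n - nat \<lfloor>f\<rfloor> + 1) * ((nat \<lfloor>f\<rfloor> - 1) choose (k - 1)) \<le> card (windows f k n)"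
proof -
  let ?A = "{0..<n - nat \<lfloor>f\<rfloor> + 1}"
  have "1 \<le> nat \<lfloor>f\<rfloor>" using assms(2) by linarith
  then have A: "?A \<subseteq> {0..<n}" using assms(3) by auto
  have "min (nat \<lfloor>f\<rfloor>) (n - i) = nat \<lfloor>f\<rfloor>" if "i \<in> ?A" for i using that assms(3) by auto
  then have "(\<Sum>i\<in>?A. (nat \<lfloor>f\<rfloor> - 1) choose (k - 1)) =
      (\<Sum>i\<in>?A. (min (nat \<lfloor>f\<rfloor>) (n - i) - 1) choose (k - 1))"
    by (intro sum.cong) simp_all
  also have "\<dots> = card {I \<in> windows f k n. Min I \<in> ?A}"
    by (rule card_windows_Min_in[OF assms(1,2) A, symmetric])
  also have "\<dots> \<le> card (windows f k n)" by (intro card_mono) auto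
  finally show ?thesis by simp
qed

lemma windows_full:
  assumes "1 \<le> k" "real n \<le> f"
  shows "windows f k n = {I. I \<subseteq> {0..<n} \<and> card I = k}"
proof -
  have "real (width I) \<le> f" if I: "I \<subseteq> {0..<n}" "card I = k" for I
  proof -
    have "finite I" "I \<noteq> {}" using I assms(1) finite_subset by fastforce+
    then have "Max I < n" using I(1) by (auto simp: subset_iff)
    then show ?thesis using assms(2) by (simp add: width_def)
  qed
  then show ?thesis by (auto simp: windows_def)
qed

lemma card_windows_full: "1 \<le> k \<Longrightarrow> real n \<le> f \<Longrightarrow> card (windows f k n) = n choose k"
  by (simp add: windows_full n_subsets)

lemma card_windows_pos:
  assumes "1 \<le> k" "real k \<le> f" "k \<le> n"
  shows "0 < card (windows f k n)"
proof -
  have "Max {0..<k} = k - 1" "Min {0..<k} = 0" using assms(1) by (auto intro!: Max_eqI Min_eqI)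
  then have "{0..<k} \<in> windows f k n" using assms by (simp add: windows_def width_def)
  then show ?thesis by (auto simp: card_gt_0_iff)
qed

definition crossing :: "nat \<Rightarrow> nat set set" where
  "crossing b = {I. Min I div b \<noteq> Max I div b}"

lemma same_block_if_not_crossing:
  assumes "I \<notin> crossing b" "finite I" "i \<in> I" "j \<in> I"
  shows "i div b = j div b"
proof -
  have "x div b = Min I div b" if "x \<in> I" for x
  proof -
    have "Min I div b \<le> x div b" "x div b \<le> Max I div b"
      using that assms(2) by (auto intro: div_le_mono)
    then show ?thesis using assms(1) by (auto simp: crossing_def)
  qed
  then show ?thesis using assms by metis
qed

lemma Min_near_boundary_if_crossing:
  assumes "I \<in> windows f k n" "1 \<le> k" "I \<in> crossing b"
  shows "b < Min I mod b + nat \<lfloor>f\<rfloor>"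
proof -
  note window = windowsD[OF assms(1,2)]
  have "Min I div b < Max I div b"
    using assms(3) window(5) by (simp add: crossing_def div_le_mono le_neq_implies_less)
  then have "(Min I div b + 1) * b \<le> Max I div b * b" by (intro mult_right_mono) auto
  also have "\<dots> \<le> Max I" by simp
  finally have "Min I div b * b + b < Min I + nat \<lfloor>f\<rfloor>" using window(5,7) by (simp add: add_mult_distrib)
  then show ?thesis using div_mult_mod_eq[of "Min I" b] by linarith
qed

lemma card_near_boundary_le:
  assumes "0 < b"
  shows "card {i. i < n \<and> b < i mod b + m} \<le> (n div b + 1) * m"
proof -
  have "card {i. i < n \<and> b < i mod b + m} \<le> card ({0..n div b} \<times> {0..<m})"
  proof (rule card_inj_on_le[of "\<lambda>i. (i div b, b - 1 - i mod b)"])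
    show "inj_on (\<lambda>i. (i div b, b - 1 - i mod b)) {i. i < n \<and> b < i mod b + m}"
    proof (rule inj_onI)
      fix i j assume "(i div b, b - 1 - i mod b) = (j div b, b - 1 - j mod b)"
      moreover have "i mod b < b" "j mod b < b" using assms by auto
      ultimately have "i div b = j div b" "i mod b = j mod b" by (simp, simp, linarith)
      then show "i = j" by (metis div_mult_mod_eq)
    qed
    show "(\<lambda>i. (i div b, b - 1 - i mod b)) ` {i. i < n \<and> b < i mod b + m} \<subseteq> {0..n div b} \<times> {0..<m}"
    proof (intro image_subsetI)
      fix i assume i: "i \<in> {i. i < n \<and> b < i mod b + m}"
      moreover have "i mod b < b" using assms by simp
      ultimately have "b - 1 - i mod b < m" by (simp, linarith)
      then show "(i div b, b - 1 - i mod b) \<in> {0..n div b} \<times> {0..<m}"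
        using i by (simp add: div_le_mono)
    qed
  qed simp
  then show ?thesis by simp
qed

lemma card_windows_crossing_le:
  assumes k_ge_1: "1 \<le> k" and f_bounds: "1 \<le> f" "2 * f \<le> real n" and b_bounds: "0 < b" "b \<le> n"
  shows "real (card (windows f k n \<inter> crossing b)) * real b \<le> 4 * f * real (card (windows f k n))"
proof -
  define m where "m = nat \<lfloor>f\<rfloor>"
  let ?C = "(m - 1) choose (k - 1)" and ?A = "{i. i < n \<and> b < i mod b + m}"
  have m_bounds: "real m \<le> f" "2 * m \<le> n" using f_bounds unfolding m_def by linarith+
  have "windows f k n \<inter> crossing b \<subseteq> {I \<in> windows f k n. Min I \<in> ?A}"
    using Min_near_boundary_if_crossing[OF _ k_ge_1] windowsD(5,6)[OF _ k_ge_1] unfolding m_def by fastforce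
  then have "card (windows f k n \<inter> crossing b) \<le> card {I \<in> windows f k n. Min I \<in> ?A}"
    by (intro card_mono) auto
  also have "\<dots> \<le> card ?A * ?C" unfolding m_def by (rule card_windows_Min_in_le[OF k_ge_1 f_bounds(1)]) auto
  also have "\<dots> \<le> (n div b + 1) * m * ?C" by (intro mult_right_mono card_near_boundary_le b_bounds) auto
  finally have "card (windows f k n \<inter> crossing b) * b \<le> (n div b + 1) * m * ?C * b"
    by (rule mult_right_mono) simp
  also have "\<dots> = ((n div b + 1) * b) * (m * ?C)" by (simp only: mult_ac)
  also have "\<dots> \<le> (4 * (n - m + 1)) * (m * ?C)"
  proof (rule mult_right_mono)
    have "(n div b + 1) * b \<le> n + b" using div_times_less_eq_dividend[of n b] by simp
    also have "\<dots> \<le> 4 * (n - m + 1)" using b_bounds(2) m_bounds(2) by arith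
    finally show "(n div b + 1) * b \<le> 4 * (n - m + 1)" .
  qed simp
  also have "\<dots> = 4 * m * ((n - m + 1) * ?C)" by (simp only: mult_ac)
  also have "\<dots> \<le> 4 * m * card (windows f k n)"
    using m_bounds card_windows_ge[OF k_ge_1 f_bounds(1), of n] by (intro mult_left_mono) (auto simp: m_def)
  finally have "real (card (windows f k n \<inter> crossing b) * b) \<le> real (4 * m * card (windows f k n))"
    by (rule of_nat_mono)
  also have "\<dots> \<le> 4 * f * real (card (windows f k n))" using m_bounds by (simp add: mult_right_mono)
  finally show ?thesis by simp
qed

subsection \<open>Inflations and lifted windows\<close>

definition infinite_direct_sum :: "nat list \<Rightarrow> nat \<Rightarrow> nat" where
  "infinite_direct_sum \<sigma> i = \<sigma> ! (i mod length \<sigma>) + length \<sigma> * (i div length \<sigma>)"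

lemma inj_infinite_direct_sum:
  assumes "is_perm \<sigma>" "\<sigma> \<noteq> []"
  shows "inj (infinite_direct_sum \<sigma>)"
proof (rule injI)
  fix i j assume eq: "infinite_direct_sum \<sigma> i = infinite_direct_sum \<sigma> j"
  let ?N = "length \<sigma>"
  have less: "i mod ?N < ?N" "\<sigma> ! (i mod ?N) < ?N" for i
    using assms by (simp_all add: is_perm_nth_less)
  have "infinite_direct_sum \<sigma> i div ?N = i div ?N" "infinite_direct_sum \<sigma> i mod ?N = \<sigma> ! (i mod ?N)" for i
    using less[of i] assms(2) by (simp_all add: infinite_direct_sum_def)
  then have "i div ?N = j div ?N" "\<sigma> ! (i mod ?N) = \<sigma> ! (j mod ?N)" using eq by metis+
  moreover from this(2) have "i mod ?N = j mod ?N"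
    using assms(1) less by (simp add: nth_eq_iff_index_eq is_perm_def)
  ultimately show "i = j" by (metis div_mult_mod_eq)
qed

lemma infinite_direct_sum_shift:
  "i < length \<sigma> \<Longrightarrow> infinite_direct_sum \<sigma> (c * length \<sigma> + i) = \<sigma> ! i + length \<sigma> * c"
  by (cases "\<sigma> = []") (simp_all add: infinite_direct_sum_def)

text \<open>Every point is replaced by \<open>b\<close> tied ones, which are left to the finer levels to separate.\<close>

definition inflation :: "nat \<Rightarrow> nat list \<Rightarrow> nat \<Rightarrow> nat" where
  "inflation b \<sigma> = infinite_direct_sum \<sigma> \<circ> (\<lambda>i. i div b)"

lemma card_transversals:
  assumes "finite C"
  shows "card {I. inj_on g I \<and> g ` I = C} = (\<Prod>c\<in>C. card (g -` {c}))"
proof -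
  let ?F = "PiE C (\<lambda>c. g -` {c})"
  have choice: "g (f c) = c" if "f \<in> ?F" "c \<in> C" for f c using that by auto
  have "inj_on (\<lambda>f. f ` C) ?F"
  proof (rule inj_onI, rule PiE_ext)
    fix f h c assume f: "f \<in> ?F" and h: "h \<in> ?F" and eq: "f ` C = h ` C" and c: "c \<in> C"
    then obtain c' where c': "c' \<in> C" "f c = h c'" by blast
    then have "c = c'" using choice[OF f c] choice[OF h, of c'] by simp
    then show "f c = h c" using c' by simp
  qed
  moreover have "(\<lambda>f. f ` C) ` ?F = {I. inj_on g I \<and> g ` I = C}"
  proof (intro equalityI subsetI)
    fix I assume "I \<in> (\<lambda>f. f ` C) ` ?F"
    then show "I \<in> {I. inj_on g I \<and> g ` I = C}"
      using choice by (auto simp: inj_on_def image_image)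
  next
    fix I assume "I \<in> {I. inj_on g I \<and> g ` I = C}"
    then have I: "inj_on g I" "g ` I = C" by auto
    have "restrict (inv_into I g) C ` C = I" using I by (auto simp: image_image)
    moreover have "restrict (inv_into I g) C \<in> ?F" using I(2) by (auto simp: f_inv_into_f)
    ultimately show "I \<in> (\<lambda>f. f ` C) ` ?F" by blast
  qed
  ultimately have "card {I. inj_on g I \<and> g ` I = C} = card ?F" using card_image by fastforce
  then show ?thesis using card_PiE[OF assms] by simp
qed

definition lifts :: "nat \<Rightarrow> nat \<Rightarrow> nat \<Rightarrow> nat set set \<Rightarrow> nat set set" where
  "lifts b N q \<B> = {I. inj_on (\<lambda>i. i div b) I \<and>
     (\<exists>c<q. \<exists>B\<in>\<B>. (\<lambda>i. i div b) ` I = (+) (c * N) ` B)}"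

lemma card_lifts:
  assumes b_pos: "0 < b" and k_ge_1: "1 \<le> k" and \<B>: "\<And>B. B \<in> \<B> \<Longrightarrow> B \<subseteq> {0..<N} \<and> card B = k"
  shows "card (lifts b N q \<B>) = q * card \<B> * b ^ k"
proof -
  define T where "T C = {I. inj_on (\<lambda>i. i div b) I \<and> (\<lambda>i. i div b) ` I = C}" for C
  define shift where "shift = (\<lambda>(c, B). (+) (c * N) ` B)"
  have fin: "finite \<B>" by (rule finite_subset[of _ "Pow {0..<N}"]) (use \<B> in auto)
  have "(\<lambda>i. i div b) -` {c} = {c * b..<c * b + b}" for c
    using dividend_less_div_times[OF b_pos] by (auto intro!: div_nat_eqI simp: add.commute mult.commute)
  then have card_T: "card (T (shift (c, B))) = b ^ k" if "B \<in> \<B>" for c B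
    using \<B>[OF that] k_ge_1 finite_subset
    by (subst T_def, subst card_transversals) (auto simp: shift_def card_image intro: card_ge_0_finite)
  have inj: "inj_on shift ({..<q} \<times> \<B>)"
  proof (rule inj_onI, clarify)
    fix c B c' B' assume B: "B \<in> \<B>" "B' \<in> \<B>" and eq: "shift (c, B) = shift (c', B')"
    obtain \<beta> where \<beta>: "\<beta> \<in> B" using \<B>[OF B(1)] k_ge_1 by fastforce
    then obtain \<beta>' where \<beta>': "\<beta>' \<in> B'" "c * N + \<beta> = c' * N + \<beta>'" using eq by (auto simp: shift_def)
    have "\<beta> < N" "\<beta>' < N" using \<beta> \<beta>'(1) \<B>[OF B(1)] \<B>[OF B(2)] by auto
    then have "(c * N + \<beta>) div N = c" "(c' * N + \<beta>') div N = c'" by auto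
    then have "c = c'" using \<beta>'(2) by metis
    then show "c = c' \<and> B = B'" using eq by (simp add: shift_def inj_image_eq_iff)
  qed
  have disjoint: "T (shift x) \<inter> T (shift y) = {}"
    if "x \<in> {..<q} \<times> \<B>" "y \<in> {..<q} \<times> \<B>" "x \<noteq> y" for x y
  proof -
    have "shift x \<noteq> shift y" using inj_onD[OF inj] that by blast
    then show ?thesis by (auto simp: T_def)
  qed
  have "lifts b N q \<B> = (\<Union>x\<in>{..<q} \<times> \<B>. T (shift x))"
    by (auto simp: lifts_def T_def shift_def)
  also have "card \<dots> = (\<Sum>x\<in>{..<q} \<times> \<B>. card (T (shift x)))"
    using fin disjoint card_T b_pos by (intro card_UN_disjoint) (auto intro!: card_ge_0_finite)
  also have "\<dots> = (\<Sum>x\<in>{..<q} \<times> \<B>. b ^ k)" using card_T by (intro sum.cong) auto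
  finally show ?thesis by (simp add: card_cartesian_product)
qed

lemma width_le_mult_width_blocks:
  assumes "finite I" "I \<noteq> {}" "0 < b"
  shows "width I \<le> width ((\<lambda>i. i div b) ` I) * b"
proof -
  have mono: "mono (\<lambda>i. i div b)" by (intro monoI div_le_mono)
  have "Max I + 1 \<le> Max I div b * b + b" using dividend_less_div_times[OF assms(3), of "Max I"] by simp
  moreover have "Min I div b * b \<le> Min I" by simp
  moreover have "Min I \<le> Max I" using assms(1,2) by simp
  moreover from this have "Min I div b * b \<le> Max I div b * b"
    by (intro mult_right_mono div_le_mono) simp_all
  ultimately show ?thesis
    unfolding width_def mono_Max_commute[OF mono assms(1,2), symmetric]
      mono_Min_commute[OF mono assms(1,2), symmetric] add_mult_distrib diff_mult_distrib mult_1
    by linarith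
qed

lemma width_translation:
  assumes "finite B" "B \<noteq> {}"
  shows "width ((+) c ` B) = width B"
  unfolding width_def
  using mono_Max_commute[of "(+) c" B] mono_Min_commute[of "(+) c" B] assms by (simp add: mono_def)

lemma lifts_subset_windows:
  assumes fit: "w * real b \<le> f" "q * N * b \<le> n" and b_pos: "0 < b" and k_ge_1: "1 \<le> k"
  shows "lifts b N q (windows w k N) \<subseteq> windows f k n"
proof
  fix I assume "I \<in> lifts b N q (windows w k N)"
  then obtain c B where I: "inj_on (\<lambda>i. i div b) I" "(\<lambda>i. i div b) ` I = (+) (c * N) ` B"
    and c_less: "c < q" and B: "B \<in> windows w k N"
    by (auto simp: lifts_def)
  note window = windowsD[OF B k_ge_1]
  have card: "card I = k" using card_image[OF I(1)] I(2) window(4) by (simp add: card_image)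
  then have fin: "finite I" "I \<noteq> {}" using k_ge_1 by (auto intro: card_ge_0_finite)
  have "I \<subseteq> {0..<n}"
  proof
    fix i assume "i \<in> I"
    then obtain \<beta> where \<beta>: "\<beta> \<in> B" "i div b = c * N + \<beta>" using I(2) by blast
    then have "i div b < (c + 1) * N" using window(3) by auto
    also have "\<dots> \<le> q * N" using c_less by (intro mult_right_mono) auto
    finally have "(i div b + 1) * b \<le> q * N * b" by (intro mult_right_mono) auto
    moreover have "i < (i div b + 1) * b" using dividend_less_div_times[OF b_pos, of i] by simp
    ultimately show "i \<in> {0..<n}" using fit(2) by simp
  qed
  moreover have "real (width I) \<le> f"
  proof -
    have "width I \<le> width B * b"
      using width_le_mult_width_blocks[OF fin b_pos] width_translation[OF window(1,2)] by (simp add: I(2))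
    then have "real (width I) \<le> real (width B) * real b" by (metis of_nat_le_iff of_nat_mult)
    also have "\<dots> \<le> w * real b" using B by (intro mult_right_mono) (auto simp: windows_def)
    finally show ?thesis using fit(1) by simp
  qed
  ultimately show "I \<in> windows f k n" using card by (simp add: windows_def)
qed

lemma inflation_lift:
  assumes \<sigma>: "is_perm \<sigma>" "\<sigma> \<noteq> []" and B: "B \<subseteq> {0..<length \<sigma>}"
    and I: "inj_on (\<lambda>i. i div b) I" "(\<lambda>i. i div b) ` I = (+) (c * length \<sigma>) ` B"
  shows "inj_on (inflation b \<sigma>) I" "pattern_on (inflation b \<sigma>) I = pat_at \<sigma> B"
proof -
  show "inj_on (inflation b \<sigma>) I"
    using comp_inj_on[OF I(1) inj_on_subset[OF inj_infinite_direct_sum[OF \<sigma>]]]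
    by (simp add: inflation_def)
  have finB: "finite B" using B finite_subset by blast
  have finI: "finite I" using finite_imageD[OF _ I(1)] I(2) finB by simp
  have mono: "strict_mono_on I (\<lambda>i. i div b)"
    using inj_onD[OF I(1)]
    by (intro strict_mono_onI) (metis div_le_mono le_neq_implies_less less_imp_le less_irrefl)
  have "pattern_on (inflation b \<sigma>) I = pattern_on (infinite_direct_sum \<sigma>) ((\<lambda>i. i div b) ` I)"
    unfolding pattern_on_image[OF finI mono] inflation_def ..
  also have "\<dots> = pattern_on (infinite_direct_sum \<sigma> \<circ> (+) (c * length \<sigma>)) B"
    unfolding I(2) using finB by (intro pattern_on_image strict_mono_onI) auto
  also have "\<dots> = pattern_on ((!) \<sigma>) B"
  proof (rule pattern_on_cong)
    fix i j assume "i \<in> B" "j \<in> B"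
    then have "i < length \<sigma>" "j < length \<sigma>" using B by auto
    then show "(infinite_direct_sum \<sigma> \<circ> (+) (c * length \<sigma>)) i <
        (infinite_direct_sum \<sigma> \<circ> (+) (c * length \<sigma>)) j \<longleftrightarrow> \<sigma> ! i < \<sigma> ! j"
      by (simp add: infinite_direct_sum_shift)
  qed
  also have "\<dots> = pat_at \<sigma> B"
    using pat_at_eq_pattern_on[OF is_perm_inj_on_nth[OF \<sigma>(1) B]] by simp
  finally show "pattern_on (inflation b \<sigma>) I = pat_at \<sigma> B" .
qed

lemma abs_frequency_diff_le:
  fixes r \<epsilon> :: real
  assumes W: "finite W" "0 < card W" and D: "D \<subseteq> W"
    and most: "(1 - \<epsilon>) * real (card W) \<le> real (card D)"
    and few: "real (card (W \<inter> X)) \<le> \<epsilon> * real (card W)"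
    and agree: "\<And>x. x \<in> D \<Longrightarrow> x \<notin> X \<Longrightarrow> P x \<longleftrightarrow> Q x"
    and frequency: "real (card {x \<in> D. Q x}) = r * real (card D)" "0 \<le> r" "r \<le> 1"
  shows "\<bar>real (card {x \<in> W. P x}) / real (card W) - r\<bar> \<le> 2 * \<epsilon>"
proof -
  have fin: "finite D" using W D finite_subset by blast
  have "{x \<in> W. P x} \<subseteq> {x \<in> D. Q x} \<union> (W - D) \<union> (W \<inter> X)" using agree D by auto
  then have "card {x \<in> W. P x} \<le> card ({x \<in> D. Q x} \<union> (W - D) \<union> (W \<inter> X))"
    using W fin by (intro card_mono) auto
  also have "\<dots> \<le> card {x \<in> D. Q x} + card (W - D) + card (W \<inter> X)"
    by (meson add_mono_thms_linordered_semiring(3) card_Un_le order_trans)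
  also have "card (W - D) = card W - card D" by (rule card_Diff_subset[OF fin D])
  finally have upper: "real (card {x \<in> W. P x}) \<le>
      r * real (card D) + (real (card W) - real (card D)) + real (card (W \<inter> X))"
    using of_nat_mono[where ?'a = real] card_mono[OF W(1) D] frequency(1) by (fastforce simp: of_nat_diff)
  have "{x \<in> D. Q x} \<subseteq> {x \<in> W. P x} \<union> (W \<inter> X)" using agree D by auto
  then have "card {x \<in> D. Q x} \<le> card ({x \<in> W. P x} \<union> (W \<inter> X))" using W by (intro card_mono) auto
  also have "\<dots> \<le> card {x \<in> W. P x} + card (W \<inter> X)" by (rule card_Un_le)
  finally have lower: "r * real (card D) \<le> real (card {x \<in> W. P x}) + real (card (W \<inter> X))"
    using of_nat_mono[where ?'a = real] frequency(1) by fastforce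
  define d where "d = real (card W) - real (card D)"
  have d_bounds: "0 \<le> d" "d \<le> \<epsilon> * real (card W)"
    using card_mono[OF W(1) D] most by (simp_all add: d_def algebra_simps)
  have "0 \<le> r * d" "r * d \<le> d" using frequency d_bounds by (auto intro: mult_left_le_one_le)
  moreover have "r * real (card W) = r * real (card D) + r * d" by (simp add: d_def algebra_simps)
  ultimately have "\<bar>real (card {x \<in> W. P x}) - r * real (card W)\<bar> \<le> 2 * \<epsilon> * real (card W)"
    using upper lower d_bounds few by (simp add: d_def)
  moreover have "real (card {x \<in> W. P x}) / real (card W) - r =
      (real (card {x \<in> W. P x}) - r * real (card W)) / real (card W)"
    using W(2) by (simp add: diff_divide_distrib)
  ultimately show ?thesis using W(2) by (simp add: abs_divide divide_le_eq)
qed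

lemma card_eq_rho_mult:
  "real (card {I \<in> windows f (length \<pi>) (length \<sigma>). pat_at \<sigma> I = \<pi>}) =
     rho f \<pi> \<sigma> * real (card (windows f (length \<pi>) (length \<sigma>)))"
proof (cases "card (windows f (length \<pi>) (length \<sigma>)) = 0")
  case True
  then have "{I \<in> windows f (length \<pi>) (length \<sigma>). pat_at \<sigma> I = \<pi>} = {}" by auto
  then show ?thesis using True by simp
qed (simp add: rho_def)

lemma rho_bounds: "0 \<le> rho f \<pi> \<sigma>" "rho f \<pi> \<sigma> \<le> 1"
proof -
  have "card {I \<in> windows f (length \<pi>) (length \<sigma>). pat_at \<sigma> I = \<pi>} \<le> card (windows f (length \<pi>) (length \<sigma>))"
    by (intro card_mono) auto
  then show "0 \<le> rho f \<pi> \<sigma>" "rho f \<pi> \<sigma> \<le> 1" by (auto simp: rho_def divide_le_eq_1)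
qed

lemma rho_inflation_approx:
  fixes \<pi> \<sigma> \<tau> :: "nat list"
  defines "k \<equiv> length \<pi>" and "N \<equiv> length \<sigma>" and "n \<equiv> length \<tau>"
  assumes \<sigma>: "is_perm \<sigma>" "\<sigma> \<noteq> []" and k_ge_1: "1 \<le> k" and b_pos: "0 < b"
    and fit: "w * real b \<le> f" "q * N * b \<le> n"
    and agree: "\<And>I. I \<in> windows f k n \<Longrightarrow> I \<notin> X \<Longrightarrow> inj_on (inflation b \<sigma>) I \<Longrightarrow>
      pat_at \<tau> I = pattern_on (inflation b \<sigma>) I"
    and most: "(1 - \<epsilon>) * real (card (windows f k n)) \<le> real (q * card (windows w k N) * b ^ k)"
    and few: "real (card (windows f k n \<inter> X)) \<le> \<epsilon> * real (card (windows f k n))"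
    and nonempty: "0 < card (windows f k n)"
  shows "\<bar>rho f \<pi> \<tau> - rho w \<pi> \<sigma>\<bar> \<le> 2 * \<epsilon>"
proof -
  let ?D = "lifts b N q (windows w k N)"
  have subset: "?D \<subseteq> windows f k n" by (rule lifts_subset_windows[OF fit b_pos k_ge_1])
  have card_D: "card ?D = q * card (windows w k N) * b ^ k"
    using b_pos k_ge_1 by (intro card_lifts) (auto simp: windows_def)
  have pattern: "inj_on (inflation b \<sigma>) I" "pattern_on (inflation b \<sigma>) I = pat_at \<sigma> B"
    if "inj_on (\<lambda>i. i div b) I" "(\<lambda>i. i div b) ` I = (+) (c * N) ` B" "B \<in> windows w k N" for I B c
    using inflation_lift[OF \<sigma> _ that(1), of B c] that(2,3) by (simp_all add: N_def windows_def)
  have "{I \<in> ?D. pattern_on (inflation b \<sigma>) I = \<pi>} = lifts b N q {B \<in> windows w k N. pat_at \<sigma> B = \<pi>}"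
    using pattern(2) by (fastforce simp: lifts_def)
  also have "card \<dots> = q * card {B \<in> windows w k N. pat_at \<sigma> B = \<pi>} * b ^ k"
    using b_pos k_ge_1 by (intro card_lifts) (auto simp: windows_def)
  finally have "card {I \<in> ?D. pattern_on (inflation b \<sigma>) I = \<pi>} =
      q * card {B \<in> windows w k N. pat_at \<sigma> B = \<pi>} * b ^ k" .
  then have "real (card {I \<in> ?D. pattern_on (inflation b \<sigma>) I = \<pi>}) = rho w \<pi> \<sigma> * real (card ?D)"
    using card_D card_eq_rho_mult[of w \<pi> \<sigma>] by (simp add: k_def N_def)
  moreover have "pat_at \<tau> I = \<pi> \<longleftrightarrow> pattern_on (inflation b \<sigma>) I = \<pi>" if "I \<in> ?D" "I \<notin> X" for I
  proof -
    have "inj_on (inflation b \<sigma>) I" using that(1) pattern(1) by (auto simp: lifts_def)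
    then show ?thesis using agree[of I] that subset by auto
  qed
  ultimately have "\<bar>real (card {I \<in> windows f k n. pat_at \<tau> I = \<pi>}) / real (card (windows f k n)) -
      rho w \<pi> \<sigma>\<bar> \<le> 2 * \<epsilon>"
    using subset nonempty most few rho_bounds
    by (intro abs_frequency_diff_le[where D = ?D and X = X]) (auto simp: card_D)
  then show ?thesis by (simp add: rho_def[of f] k_def n_def)
qed

subsection \<open>Scaling functions and domination\<close>

lemma scaling_functionD:
  assumes "scaling_function f"
  shows "filterlim f at_top sequentially" "dominated f real"
    "\<forall>\<^sub>F n in sequentially. f n \<le> real n"
proof -
  show "filterlim f at_top sequentially" "dominated f real"
    using assms by (simp_all add: scaling_function_def dominated_def)
  show "\<forall>\<^sub>F n in sequentially. f n \<le> real n"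
    using eventually_ge_at_top[of 1] by eventually_elim (use assms in \<open>simp add: scaling_function_def\<close>)
qed

lemma dominated_const:
  assumes "filterlim h at_top sequentially"
  shows "dominated (\<lambda>_. 1) h"
  unfolding dominated_def
  by (intro tendsto_divide_0[OF tendsto_const] filterlim_at_top_imp_at_infinity assms)

lemma filterlim_at_top_if_dominates:
  assumes "dominated g h" "\<forall>\<^sub>F n in sequentially. 1 \<le> g n" "\<forall>\<^sub>F n in sequentially. 1 \<le> h n"
  shows "filterlim h at_top sequentially"
proof -
  have "(\<lambda>n. inverse (h n)) \<longlonglongrightarrow> 0"
  proof (rule tendsto_sandwich[OF _ _ tendsto_const])
    show "(\<lambda>n. g n / h n) \<longlonglongrightarrow> 0" using assms(1) by (simp add: dominated_def)
    show "\<forall>\<^sub>F n in sequentially. 0 \<le> inverse (h n)" using assms(3) by eventually_elim simp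
    show "\<forall>\<^sub>F n in sequentially. inverse (h n) \<le> g n / h n"
      using assms(2,3) by eventually_elim (simp add: inverse_eq_divide divide_right_mono)
  qed
  moreover have "\<forall>\<^sub>F n in sequentially. 0 < inverse (h n)" using assms(3) by eventually_elim simp
  ultimately show ?thesis using filterlim_inverse_at_top[of "\<lambda>n. inverse (h n)"] by simp
qed

lemma eventually_less_if_dominated:
  assumes "dominated f g" "\<forall>\<^sub>F n in sequentially. 1 \<le> g n"
  shows "\<forall>\<^sub>F n in sequentially. f n < g n"
proof -
  have "\<forall>\<^sub>F n in sequentially. f n / g n < 1"
    using assms(1) unfolding dominated_def by (intro order_tendstoD) auto
  then show ?thesis using assms(2) by eventually_elim (simp add: divide_less_eq)
qed

subsection \<open>Asymptotic window counts\<close>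

lemma tendsto_binomial_over_power: "(\<lambda>n. real (n choose s) / real n ^ s) \<longlonglongrightarrow> 1 / fact s"
proof -
  have "(\<lambda>n. (real n - real i) / real n) \<longlonglongrightarrow> 1" for i
  proof -
    have "(\<lambda>n. 1 - real i * (1 / real n)) \<longlonglongrightarrow> 1 - real i * 0"
      by (intro tendsto_intros lim_1_over_n)
    moreover have "\<forall>\<^sub>F n in sequentially. 1 - real i * (1 / real n) = (real n - real i) / real n"
      using eventually_gt_at_top[of 0] by eventually_elim (simp add: diff_divide_distrib)
    ultimately show ?thesis by (simp add: Lim_transform_eventually)
  qed
  then have "(\<lambda>n. (\<Prod>i = 0..<s. (real n - real i) / real n) / fact s) \<longlonglongrightarrow> (\<Prod>i = 0..<s. 1) / fact s"
    by (intro tendsto_intros) auto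
  moreover have "(\<Prod>i = 0..<s. (real n - real i) / real n) / fact s = real (n choose s) / real n ^ s" for n
    by (simp add: prod_dividef binomial_gbinomial gbinomial_prod_rev)
  ultimately show ?thesis by simp
qed

lemma tendsto_card_windows_sublinear:
  assumes k_ge_1: "1 \<le> k" and f_ge_k: "\<forall>\<^sub>F j in net. real k \<le> f j"
    and n_pos: "\<forall>\<^sub>F j in net. 0 < n j" and sublinear: "((\<lambda>j. f j / real (n j)) \<longlongrightarrow> 0) net"
  shows "((\<lambda>j. real (card (windows (f j) k (n j))) /
    (real (n j) * real ((nat \<lfloor>f j\<rfloor> - 1) choose (k - 1)))) \<longlongrightarrow> 1) net"
proof (rule tendsto_sandwich[OF _ _ _ tendsto_const])
  show "((\<lambda>j. 1 - f j / real (n j)) \<longlongrightarrow> 1) net"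
    using tendsto_diff[OF tendsto_const sublinear, of 1] by simp
  have C_pos: "0 < (nat \<lfloor>f j\<rfloor> - 1) choose (k - 1)" if "real k \<le> f j" for j
    using that by (intro zero_less_binomial diff_le_mono) (rule le_nat_floor)
  show "\<forall>\<^sub>F j in net. real (card (windows (f j) k (n j))) /
      (real (n j) * real ((nat \<lfloor>f j\<rfloor> - 1) choose (k - 1))) \<le> 1"
    using f_ge_k n_pos
  proof eventually_elim
    case (elim j)
    have "real (card (windows (f j) k (n j))) \<le> real (n j * ((nat \<lfloor>f j\<rfloor> - 1) choose (k - 1)))"
      using k_ge_1 elim by (intro of_nat_mono card_windows_le) auto
    then show ?case using C_pos elim by (simp add: divide_le_eq)
  qed
  show "\<forall>\<^sub>F j in net. 1 - f j / real (n j) \<le> real (card (windows (f j) k (n j))) /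
      (real (n j) * real ((nat \<lfloor>f j\<rfloor> - 1) choose (k - 1)))"
    using f_ge_k n_pos order_tendstoD(2)[OF sublinear, of 1, simplified]
  proof eventually_elim
    case (elim j)
    let ?m = "nat \<lfloor>f j\<rfloor>"
    let ?C = "(?m - 1) choose (k - 1)"
    have "f j < real (n j)" using elim by (simp add: divide_less_eq)
    then have m_bounds: "real ?m \<le> f j" "?m \<le> n j" using elim(1) by linarith+
    have "(real (n j) - f j) * real ?C \<le> real ((n j - ?m + 1) * ?C)"
      unfolding of_nat_mult using m_bounds by (intro mult_right_mono) (auto simp: of_nat_diff)
    also have "\<dots> \<le> real (card (windows (f j) k (n j)))"
      using k_ge_1 elim m_bounds by (intro of_nat_mono card_windows_ge) auto
    finally have "(real (n j) - f j) * real ?C / (real (n j) * real ?C) \<le>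
        real (card (windows (f j) k (n j))) / (real (n j) * real ?C)"
      by (rule divide_right_mono) simp
    then show ?case using C_pos[OF elim(1)] elim(2) by (simp add: diff_divide_distrib)
  qed
qed

lemma filterlim_nat_floor_minus:
  fixes f :: "'a \<Rightarrow> real"
  assumes "filterlim f at_top net"
  shows "filterlim (\<lambda>j. nat \<lfloor>f j\<rfloor> - c) at_top net"
proof -
  have "filterlim (\<lambda>j. - (1 + real c) + f j) at_top net"
    by (rule filterlim_tendsto_add_at_top[OF tendsto_const assms])
  then have "filterlim (\<lambda>j. real (nat \<lfloor>f j\<rfloor> - c)) at_top net"
    by (rule filterlim_at_top_mono) (intro always_eventually allI, linarith)
  then show ?thesis by (simp add: filterlim_sequentially_iff_filterlim_real)
qed

lemma tendsto_nat_floor_minus_ratio: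
  fixes f :: "'a \<Rightarrow> real"
  assumes "filterlim f at_top net"
  shows "((\<lambda>j. real (nat \<lfloor>f j\<rfloor> - c) / f j) \<longlongrightarrow> 1) net"
proof (rule tendsto_sandwich[OF _ _ _ tendsto_const])
  have pos: "\<forall>\<^sub>F j in net. 0 < f j" using assms by (simp add: filterlim_at_top_dense)
  have "((\<lambda>j. 1 - (1 + real c) / f j) \<longlongrightarrow> 1 - 0) net"
    by (intro tendsto_intros tendsto_divide_0[OF tendsto_const] filterlim_at_top_imp_at_infinity assms)
  then show "((\<lambda>j. 1 - (1 + real c) / f j) \<longlongrightarrow> 1) net" by simp
  show "\<forall>\<^sub>F j in net. 1 - (1 + real c) / f j \<le> real (nat \<lfloor>f j\<rfloor> - c) / f j"
    using pos
  proof eventually_elim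
    case (elim j)
    have "f j - (1 + real c) \<le> real (nat \<lfloor>f j\<rfloor> - c)" by linarith
    then have "(f j - (1 + real c)) / f j \<le> real (nat \<lfloor>f j\<rfloor> - c) / f j"
      using elim by (intro divide_right_mono) auto
    then show ?case using elim by (simp add: diff_divide_distrib)
  qed
  show "\<forall>\<^sub>F j in net. real (nat \<lfloor>f j\<rfloor> - c) / f j \<le> 1"
    using pos
  proof eventually_elim
    case (elim j)
    then have "real (nat \<lfloor>f j\<rfloor> - c) \<le> f j" by linarith
    then show ?case using elim by simp
  qed
qed

text \<open>Raising the width to at least \<open>k\<close> makes the windows of the local and of the global density
  those at the scales \<open>1\<close> and \<open>n\<close>.\<close>

abbreviation scale_windows :: "real \<Rightarrow> nat \<Rightarrow> nat \<Rightarrow> nat set set" where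
  "scale_windows x k n \<equiv> windows (max (real k) x) k n"

text \<open>The limit of the normalized count depends only on whether the scale is constant, sublinear or
  full. It is therefore the same for the permutation under construction and for the models of its
  levels.\<close>

definition normalized_count :: "nat \<Rightarrow> real \<Rightarrow> nat \<Rightarrow> real" where
  "normalized_count k x n = real (card (scale_windows x k n)) / (real n * x ^ (k - 1))"

lemma tendsto_normalized_count_const:
  assumes "1 \<le> k"
  shows "(\<lambda>n. normalized_count k 1 n) \<longlonglongrightarrow> 1"
proof -
  have "(\<lambda>n. real k / real n) \<longlonglongrightarrow> 0"
    using tendsto_mult[OF tendsto_const lim_1_over_n, of "real k"] by simp
  then have "(\<lambda>n. real (card (windows (real k) k n)) /
      (real n * real ((nat \<lfloor>real k\<rfloor> - 1) choose (k - 1)))) \<longlonglongrightarrow> 1"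
    using assms by (intro tendsto_card_windows_sublinear) (auto intro: eventually_gt_at_top)
  then show ?thesis using assms by (simp add: normalized_count_def max_absorb1)
qed

lemma tendsto_normalized_count_sublinear:
  assumes k_ge_1: "1 \<le> k" and f_at_top: "filterlim f at_top net"
    and n_pos: "\<forall>\<^sub>F j in net. 0 < n j" and sublinear: "((\<lambda>j. f j / real (n j)) \<longlongrightarrow> 0) net"
  shows "((\<lambda>j. normalized_count k (f j) (n j)) \<longlongrightarrow> 1 / fact (k - 1)) net"
proof -
  let ?m = "\<lambda>j. nat \<lfloor>f j\<rfloor> - 1"
  let ?C = "\<lambda>j. real (?m j choose (k - 1))"
  have f_ge: "\<forall>\<^sub>F j in net. c \<le> f j" for c using f_at_top by (simp add: filterlim_at_top)
  have "((\<lambda>j. ?C j / real (?m j) ^ (k - 1)) \<longlongrightarrow> 1 / fact (k - 1)) net"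
    by (rule filterlim_compose[OF tendsto_binomial_over_power filterlim_nat_floor_minus[OF f_at_top]])
  then have "((\<lambda>j. real (card (windows (f j) k (n j))) / (real (n j) * ?C j) *
      (?C j / real (?m j) ^ (k - 1) * (real (?m j) / f j) ^ (k - 1)))
      \<longlongrightarrow> 1 * (1 / fact (k - 1) * 1 ^ (k - 1))) net"
    by (intro tendsto_mult tendsto_power tendsto_card_windows_sublinear tendsto_nat_floor_minus_ratio
        k_ge_1 f_at_top f_ge n_pos sublinear)
  moreover have "\<forall>\<^sub>F j in net. real (card (windows (f j) k (n j))) / (real (n j) * ?C j) *
      (?C j / real (?m j) ^ (k - 1) * (real (?m j) / f j) ^ (k - 1)) =
      normalized_count k (f j) (n j)"
    using f_ge[of "real k"] f_ge[of 2]
  proof eventually_elim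
    case (elim j)
    have "k - 1 \<le> ?m j" using elim(1) by (intro diff_le_mono le_nat_floor)
    then have "?C j \<noteq> 0" by simp
    moreover have "real (?m j) \<noteq> 0" using elim(2) by linarith
    ultimately have "real (card (windows (f j) k (n j))) / (real (n j) * ?C j) *
        (?C j / real (?m j) ^ (k - 1) * (real (?m j) / f j) ^ (k - 1)) =
        real (card (windows (f j) k (n j))) / (real (n j) * f j ^ (k - 1))"
      by (simp only: power_divide) (simp add: field_simps)
    then show ?case using elim(1) by (simp add: normalized_count_def max_absorb2)
  qed
  ultimately show ?thesis by (simp add: Lim_transform_eventually)
qed

lemma tendsto_normalized_count_full:
  assumes "1 \<le> k"
  shows "(\<lambda>n. normalized_count k (real n) n) \<longlonglongrightarrow> 1 / fact k"
proof -
  have "\<forall>\<^sub>F n in sequentially. real (n choose k) / real n ^ k = normalized_count k (real n) n"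
    using eventually_ge_at_top[of k]
  proof eventually_elim
    case (elim n)
    then show ?case
      using assms power_Suc[of "real n" "k - 1"]
      by (simp add: normalized_count_def max_absorb2 card_windows_full)
  qed
  then show ?thesis by (rule Lim_transform_eventually[OF tendsto_binomial_over_power])
qed

lemma tendsto_crossing_ratio:
  fixes f :: "nat \<Rightarrow> real" and b :: "nat \<Rightarrow> nat"
  assumes k_ge_1: "1 \<le> k" and f_ge_1: "\<forall>\<^sub>F n in sequentially. 1 \<le> f n"
    and b_bounds: "\<forall>\<^sub>F n in sequentially. 0 < b n \<and> b n \<le> n"
    and small: "(\<lambda>n. f n / real (b n)) \<longlonglongrightarrow> 0"
  shows "(\<lambda>n. real (card (windows (f n) k n \<inter> crossing (b n))) / real (card (windows (f n) k n))) \<longlonglongrightarrow> 0"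
proof (rule tendsto_sandwich[OF _ _ tendsto_const])
  show "(\<lambda>n. 4 * (f n / real (b n))) \<longlonglongrightarrow> 0"
    using tendsto_mult_right_zero[OF small] by simp
  have "\<forall>\<^sub>F n in sequentially. f n / real (b n) < 1 / 2"
    using order_tendstoD(2)[OF small, of "1 / 2"] by simp
  then show "\<forall>\<^sub>F n in sequentially. real (card (windows (f n) k n \<inter> crossing (b n))) /
      real (card (windows (f n) k n)) \<le> 4 * (f n / real (b n))"
    using f_ge_1 b_bounds
  proof eventually_elim
    case (elim n)
    then have "2 * f n \<le> real (b n)" by (simp add: field_simps)
    then have "real (card (windows (f n) k n \<inter> crossing (b n))) * real (b n)
        \<le> 4 * f n * real (card (windows (f n) k n))"
      using k_ge_1 elim by (intro card_windows_crossing_le) auto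
    then have "real (card (windows (f n) k n \<inter> crossing (b n)))
        \<le> 4 * (f n / real (b n)) * real (card (windows (f n) k n))"
      using elim by (simp add: field_simps)
    moreover have "0 \<le> 4 * (f n / real (b n))" using elim by simp
    ultimately show ?case
      by (cases "card (windows (f n) k n) = 0") (simp_all add: divide_le_eq)
  qed
qed auto

subsection \<open>Covering by lifted windows\<close>

definition block :: "(nat \<Rightarrow> real) \<Rightarrow> real \<Rightarrow> nat \<Rightarrow> nat" where
  "block F w n = nat \<lfloor>F n / w\<rfloor>"

lemma block_le:
  assumes "0 < w" "0 \<le> F n"
  shows "real (block F w n) \<le> F n / w"
  using assms by (simp add: block_def)

lemma tendsto_block_ratio:
  assumes "0 < w" "filterlim F at_top sequentially"
  shows "(\<lambda>n. real (block F w n) / F n) \<longlonglongrightarrow> 1 / w"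
proof -
  have "filterlim (\<lambda>n. 1 / w * F n) at_top sequentially"
    using assms(1) by (intro filterlim_tendsto_pos_mult_at_top[OF tendsto_const _ assms(2)]) simp
  then have "(\<lambda>n. real (nat \<lfloor>F n / w\<rfloor> - 0) / (F n / w)) \<longlonglongrightarrow> 1"
    by (intro tendsto_nat_floor_minus_ratio) simp
  then have "(\<lambda>n. real (nat \<lfloor>F n / w\<rfloor> - 0) / (F n / w) / w) \<longlonglongrightarrow> 1 / w"
    using assms(1) by (intro tendsto_divide tendsto_const) auto
  then show ?thesis using assms(1) by (simp add: block_def)
qed

lemma tendsto_div_mult_ratio:
  fixes M :: "nat \<Rightarrow> nat"
  assumes "\<forall>\<^sub>F n in sequentially. 0 < M n" "(\<lambda>n. real (M n) / real n) \<longlonglongrightarrow> 0"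
  shows "(\<lambda>n. real (n div M n * M n) / real n) \<longlonglongrightarrow> 1"
proof (rule tendsto_sandwich[OF _ _ _ tendsto_const])
  show "(\<lambda>n. 1 - real (M n) / real n) \<longlonglongrightarrow> 1"
    using tendsto_diff[OF tendsto_const assms(2), of 1] by simp
  show "\<forall>\<^sub>F n in sequentially. 1 - real (M n) / real n \<le> real (n div M n * M n) / real n"
    using assms(1) eventually_gt_at_top[of 0]
  proof eventually_elim
    case (elim n)
    have "real n \<le> real (n div M n * M n + M n)"
      using dividend_less_div_times[OF elim(1), of n] by (intro of_nat_mono) simp
    then have "(real n - real (M n)) / real n \<le> real (n div M n * M n) / real n"
      by (intro divide_right_mono) auto
    then show ?case using elim(2) by (simp add: diff_divide_distrib)
  qed
  show "\<forall>\<^sub>F n in sequentially. real (n div M n * M n) / real n \<le> 1"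
    using eventually_gt_at_top[of 0] by eventually_elim (simp add: divide_le_eq flip: of_nat_mult)
qed

definition tiles :: "nat \<Rightarrow> (nat \<Rightarrow> real) \<Rightarrow> real \<Rightarrow> nat \<Rightarrow> bool" where
  "tiles k F w N \<longleftrightarrow>
     (\<lambda>n. real (block F w n) / F n) \<longlonglongrightarrow> 1 / w \<and>
     (\<forall>\<^sub>F n in sequentially. max (real k) w * real (block F w n) \<le> max (real k) (F n)) \<and>
     (\<exists>q. (\<forall>\<^sub>F n in sequentially. q n * N * block F w n \<le> n) \<and>
        (\<lambda>n. real (q n * block F w n) / real n) \<longlonglongrightarrow> 1 / real N)"

lemma tilesI_small_blocks:
  assumes ratio: "(\<lambda>n. real (block F w n) / F n) \<longlonglongrightarrow> 1 / w"
    and fit: "\<forall>\<^sub>F n in sequentially. max (real k) w * real (block F w n) \<le> max (real k) (F n)"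
    and N_pos: "0 < N" and pos: "\<forall>\<^sub>F n in sequentially. 0 < block F w n"
    and small: "(\<lambda>n. real (block F w n) / real n) \<longlonglongrightarrow> 0"
  shows "tiles k F w N"
  unfolding tiles_def
proof (intro conjI exI)
  let ?q = "\<lambda>n. n div (N * block F w n)"
  have "(\<lambda>n. real (N * block F w n) / real n) \<longlonglongrightarrow> 0"
    using tendsto_mult_right_zero[OF small, of "real N"] by simp
  then have "(\<lambda>n. real (?q n * (N * block F w n)) / real n / real N) \<longlonglongrightarrow> 1 / real N"
    using pos N_pos
    by (intro tendsto_divide tendsto_div_mult_ratio tendsto_const) (auto elim: eventually_mono)
  then show "(\<lambda>n. real (?q n * block F w n) / real n) \<longlonglongrightarrow> 1 / real N"
    using N_pos by (simp add: field_simps)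
  have "?q n * N * block F w n \<le> n" for n
    using div_times_less_eq_dividend[of n "N * block F w n"] by (simp only: mult.assoc)
  then show "\<forall>\<^sub>F n in sequentially. ?q n * N * block F w n \<le> n" by simp
qed (fact ratio fit)+

lemma tiles_const:
  assumes "1 \<le> k" "0 < N"
  shows "tiles k (\<lambda>_. 1) 1 N"
  using assms by (intro tilesI_small_blocks) (simp_all add: block_def lim_1_over_n)

lemma max_width_mult_block_le:
  assumes "real k \<le> w" "0 < w" "0 \<le> F n"
  shows "max (real k) w * real (block F w n) \<le> max (real k) (F n)"
proof -
  have "w * real (block F w n) \<le> F n"
    using block_le[of w F n] assms(2,3) by (simp add: field_simps)
  then show ?thesis using assms(1) by (simp add: max_absorb2)
qed

lemma tiles_scaling:
  assumes F: "scaling_function F" and w_bounds: "real k \<le> w" "0 < w" and N_pos: "0 < N"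
  shows "tiles k F w N"
proof (rule tilesI_small_blocks[OF _ _ N_pos])
  have top: "filterlim F at_top sequentially" and sublinear: "(\<lambda>n. F n / real n) \<longlonglongrightarrow> 0"
    using scaling_functionD[OF F] by (simp_all add: dominated_def)
  have F_ge: "\<forall>\<^sub>F n in sequentially. c \<le> F n" for c
    using top by (simp add: filterlim_at_top)
  show ratio: "(\<lambda>n. real (block F w n) / F n) \<longlonglongrightarrow> 1 / w" by (rule tendsto_block_ratio[OF w_bounds(2) top])
  show "\<forall>\<^sub>F n in sequentially. max (real k) w * real (block F w n) \<le> max (real k) (F n)"
    using F_ge[of 0] by eventually_elim (rule max_width_mult_block_le[OF w_bounds])
  show "\<forall>\<^sub>F n in sequentially. 0 < block F w n"
    using F_ge[of w] by eventually_elim (use w_bounds in \<open>simp add: block_def\<close>)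
  have "(\<lambda>n. real (block F w n) / F n * (F n / real n)) \<longlonglongrightarrow> 1 / w * 0"
    by (intro tendsto_mult ratio sublinear)
  moreover have "\<forall>\<^sub>F n in sequentially.
      real (block F w n) / F n * (F n / real n) = real (block F w n) / real n"
    using F_ge[of 1] by eventually_elim simp
  ultimately show "(\<lambda>n. real (block F w n) / real n) \<longlonglongrightarrow> 0" by (simp add: Lim_transform_eventually)
qed

lemma tiles_full:
  assumes "k \<le> N" "0 < N"
  shows "tiles k real (real N) N"
  unfolding tiles_def
proof (intro conjI exI)
  show ratio: "(\<lambda>n. real (block real (real N) n) / real n) \<longlonglongrightarrow> 1 / real N"
    using assms(2) by (intro tendsto_block_ratio filterlim_real_sequentially) simp
  show "\<forall>\<^sub>F n in sequentially. max (real k) (real N) * real (block real (real N) n) \<le> max (real k) (real n)"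
    using assms by (intro always_eventually allI max_width_mult_block_le) auto
  show "(\<lambda>n. real (1 * block real (real N) n) / real n) \<longlonglongrightarrow> 1 / real N" using ratio by simp
  show "\<forall>\<^sub>F n in sequentially. 1 * N * block real (real N) n \<le> n"
    by (simp add: block_def floor_divide_of_nat_eq)
qed

lemma eventually_covered_by_lifts:
  assumes tiles: "tiles k F w N" and k_ge_1: "1 \<le> k" and pos: "\<forall>\<^sub>F n in sequentially. 0 < F n"
    and count: "(\<lambda>n. normalized_count k (F n) n) \<longlonglongrightarrow> c"
    and dense: "(1 - \<epsilon>) * c < normalized_count k w N"
  obtains q where "\<forall>\<^sub>F n in sequentially. max (real k) w * real (block F w n) \<le> max (real k) (F n) \<and>
    q n * N * block F w n \<le> n \<and>
    (1 - \<epsilon>) * real (card (scale_windows (F n) k n)) \<le>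
      real (q n * card (scale_windows w k N) * block F w n ^ k)"
proof -
  define b where "b = block F w"
  define V where "V = real (card (scale_windows w k N))"
  obtain q where fit: "\<forall>\<^sub>F n in sequentially. max (real k) w * real (b n) \<le> max (real k) (F n)"
      "\<forall>\<^sub>F n in sequentially. q n * N * b n \<le> n"
    and ratios: "(\<lambda>n. real (b n) / F n) \<longlonglongrightarrow> 1 / w" "(\<lambda>n. real (q n * b n) / real n) \<longlonglongrightarrow> 1 / real N"
    using tiles unfolding tiles_def b_def by blast
  have "(\<lambda>n. real (q n * b n) / real n * (real (b n) / F n) ^ (k - 1) * V -
      (1 - \<epsilon>) * normalized_count k (F n) n) \<longlonglongrightarrow>
      1 / real N * (1 / w) ^ (k - 1) * V - (1 - \<epsilon>) * c"
    by (intro tendsto_intros ratios count)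
  also have "1 / real N * (1 / w) ^ (k - 1) * V = normalized_count k w N"
    by (simp add: normalized_count_def V_def power_one_over field_simps)
  finally have "\<forall>\<^sub>F n in sequentially. 0 < real (q n * b n) / real n * (real (b n) / F n) ^ (k - 1) * V -
      (1 - \<epsilon>) * normalized_count k (F n) n"
    using dense by (intro order_tendstoD) auto
  then have "\<forall>\<^sub>F n in sequentially. (1 - \<epsilon>) * real (card (scale_windows (F n) k n)) \<le>
      real (q n) * V * real (b n) ^ k"
    using pos eventually_gt_at_top[of 0]
  proof eventually_elim
    case (elim n)
    have "real (b n) ^ k = real (b n) * real (b n) ^ (k - 1)" using k_ge_1 by (simp flip: power_Suc)
    then show ?case
      using elim by (simp add: normalized_count_def power_divide field_simps)
  qed
  then show ?thesis
    using fit by (intro that[of q]) (simp add: eventually_conj_iff b_def V_def)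
qed

subsection \<open>Occurrences of patterns in planar point sets\<close>

definition forms :: "nat list \<Rightarrow> nat set \<Rightarrow> (nat \<Rightarrow> real \<times> real) \<Rightarrow> bool" where
  "forms \<pi> S p \<longleftrightarrow> (\<exists>s. (\<forall>a<length \<pi>. s a \<in> S) \<and>
      (\<forall>a<length \<pi>. \<forall>b<length \<pi>.
         (a < b \<longrightarrow> fst (p (s a)) < fst (p (s b))) \<and>
         (snd (p (s a)) < snd (p (s b)) \<longleftrightarrow> \<pi> ! a < \<pi> ! b)))"

lemma pattern_event_eq_forms: "pattern_event \<pi> = {p. forms \<pi> {0..<length \<pi>} p}"
  by (simp add: pattern_event_def forms_def)

lemma forms_cong:
  assumes "\<And>a. a \<in> S \<Longrightarrow> p a = p' a"
  shows "forms \<pi> S p \<longleftrightarrow> forms \<pi> S p'"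
  using assms unfolding forms_def by (intro ex_cong1) auto

lemma forms_image: "forms \<pi> (e ` S) p \<longleftrightarrow> forms \<pi> S (p \<circ> e)"
proof
  assume "forms \<pi> S (p \<circ> e)"
  then obtain s where s: "\<forall>a<length \<pi>. s a \<in> S"
    "\<forall>a<length \<pi>. \<forall>b<length \<pi>. (a < b \<longrightarrow> fst (p (e (s a))) < fst (p (e (s b)))) \<and>
       (snd (p (e (s a))) < snd (p (e (s b))) \<longleftrightarrow> \<pi> ! a < \<pi> ! b)"
    unfolding forms_def comp_apply by blast
  then show "forms \<pi> (e ` S) p"
    unfolding forms_def by (intro exI[of _ "e \<circ> s"]) simp
next
  assume "forms \<pi> (e ` S) p"
  then obtain s where s: "\<forall>a<length \<pi>. s a \<in> e ` S"
    "\<forall>a<length \<pi>. \<forall>b<length \<pi>. (a < b \<longrightarrow> fst (p (s a)) < fst (p (s b))) \<and>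
       (snd (p (s a)) < snd (p (s b)) \<longleftrightarrow> \<pi> ! a < \<pi> ! b)"
    unfolding forms_def by blast
  have "\<forall>a. \<exists>i. a < length \<pi> \<longrightarrow> i \<in> S \<and> s a = e i" using s(1) by blast
  then obtain t where "\<forall>a<length \<pi>. t a \<in> S \<and> s a = e (t a)" by metis
  then show "forms \<pi> S (p \<circ> e)"
    unfolding forms_def using s(2) by (intro exI[of _ t]) simp
qed

lemma map_upt_eq_sorted_list_of_set:
  assumes S: "finite S" "card S = k" and s: "\<And>a. a < k \<Longrightarrow> s a \<in> S" "\<And>a b. a < b \<Longrightarrow> b < k \<Longrightarrow> s a < s b"
  shows "map s [0..<k] = sorted_list_of_set S"
proof -
  have strict: "sorted_wrt (<) (map s [0..<k])"
    using s(2) by (simp add: sorted_wrt_iff_nth_less)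
  then have "distinct (map s [0..<k])" by (simp only: strict_sorted_iff)
  then have "card (set (map s [0..<k])) = card S" using S(2) by (simp only: distinct_card) simp
  then have "set (map s [0..<k]) = S" using S(1) s(1) by (intro card_subset_eq) auto
  then show ?thesis using strict by (metis sorted_list_of_set.idem_if_sorted_distinct strict_sorted_iff)
qed

lemma forms_iff_pattern_on:
  assumes \<pi>: "is_perm \<pi>" and S: "finite S" "card S = length \<pi>" and mono: "strict_mono_on S (\<lambda>i. fst (p i))"
  shows "forms \<pi> S p \<longleftrightarrow> pattern_on (\<lambda>i. snd (p i)) S = \<pi>"
  unfolding pattern_on_eq_iff[OF \<pi> S]
proof
  let ?xs = "sorted_list_of_set S"
  assume "forms \<pi> S p"
  then obtain s where s: "\<forall>a<length \<pi>. s a \<in> S"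
    "\<forall>a<length \<pi>. \<forall>b<length \<pi>. (a < b \<longrightarrow> fst (p (s a)) < fst (p (s b))) \<and>
       (snd (p (s a)) < snd (p (s b)) \<longleftrightarrow> \<pi> ! a < \<pi> ! b)"
    unfolding forms_def by blast
  have "s a < s b" if "a < b" "b < length \<pi>" for a b
    using s that strict_mono_on_less[OF mono, of "s a" "s b"] by simp
  then have "map s [0..<length \<pi>] = ?xs" using s(1) S by (intro map_upt_eq_sorted_list_of_set) auto
  then have "?xs ! a = s a" if "a < length \<pi>" for a using that by (metis add_0 diff_zero nth_map_upt)
  then show "\<forall>a<length \<pi>. \<forall>b<length \<pi>. snd (p (?xs ! a)) < snd (p (?xs ! b)) \<longleftrightarrow> \<pi> ! a < \<pi> ! b"
    using s(2) by simp
next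
  let ?xs = "sorted_list_of_set S"
  assume order: "\<forall>a<length \<pi>. \<forall>b<length \<pi>. snd (p (?xs ! a)) < snd (p (?xs ! b)) \<longleftrightarrow> \<pi> ! a < \<pi> ! b"
  have xs: "?xs ! a \<in> S" if "a < length \<pi>" for a using that S nth_mem[of a ?xs] by simp
  moreover have "fst (p (?xs ! a)) < fst (p (?xs ! b))" if "a < b" "b < length \<pi>" for a b
    using that S xs by (intro strict_mono_onD[OF mono] sorted_wrt_nth_less[of "(<)" ?xs]) auto
  ultimately show "forms \<pi> S p"
    unfolding forms_def using order by (intro exI[of _ "(!) ?xs"]) auto
qed

lemma ex_sorting_bij:
  fixes u :: "'b \<Rightarrow> 'a::linorder"
  assumes "finite A" "inj_on u A"
  obtains e where "bij_betw e {0..<card A} A" "strict_mono_on {0..<card A} (u \<circ> e)"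
proof -
  define e where "e = inv_into A (rank_on u A)"
  have rank: "bij_betw (rank_on u A) A {0..<card A}" by (rule bij_betw_rank_on[OF assms])
  have e: "bij_betw e {0..<card A} A" unfolding e_def by (rule bij_betw_inv_into[OF rank])
  have rank_e: "rank_on u A (e i) = i" if "i \<in> {0..<card A}" for i
    unfolding e_def using that rank by (intro f_inv_into_f) (simp add: bij_betw_def)
  have "u (e i) < u (e j)" if "i \<in> {0..<card A}" "j \<in> {0..<card A}" "i < j" for i j
    using that rank_e rank_on_less_iff[OF assms(1), of "e i" "e j" u] bij_betwE[OF e] by simp
  then show ?thesis using that e by (simp add: strict_mono_on_def)
qed

definition sample_density :: "nat list \<Rightarrow> nat \<Rightarrow> (nat \<Rightarrow> real \<times> real) \<Rightarrow> real" where
  "sample_density \<pi> N p =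
     real (card {S \<in> Pow {0..<N}. card S = length \<pi> \<and> forms \<pi> S p}) / real (N choose length \<pi>)"

lemma ex_perm_of_points:
  assumes x: "inj_on (\<lambda>i. fst (p i)) {0..<N}" and y: "inj_on (\<lambda>i. snd (p i)) {0..<N}"
  obtains \<sigma> where "is_perm \<sigma>" "length \<sigma> = N"
    "\<And>\<pi>. \<pi> \<in> PermS \<Longrightarrow> global_density \<pi> \<sigma> = sample_density \<pi> N p"
proof -
  obtain e where e: "bij_betw e {0..<N} {0..<N}" and mono: "strict_mono_on {0..<N} ((\<lambda>i. fst (p i)) \<circ> e)"
    using ex_sorting_bij[OF _ x] by auto
  define u where "u = (\<lambda>i. snd ((p \<circ> e) i))"
  define \<sigma> where "\<sigma> = pattern_on u {0..<N}"
  have inj_u: "inj_on u {0..<N}"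
    using comp_inj_on[OF bij_betw_imp_inj_on[OF e], of "\<lambda>i. snd (p i)"] e y
    by (simp add: u_def comp_def bij_betw_def)
  have "global_density \<pi> \<sigma> = sample_density \<pi> N p" if "\<pi> \<in> PermS" for \<pi>
  proof -
    have \<pi>: "is_perm \<pi>" "1 \<le> length \<pi>" using that by (auto simp: PermS_def)
    have "pat_at \<sigma> I = \<pi> \<longleftrightarrow> forms \<pi> (e ` I) p" if I: "I \<subseteq> {0..<N}" "card I = length \<pi>" for I
    proof -
      have "finite I" using I(1) finite_subset by blast
      moreover have "strict_mono_on I (\<lambda>i. fst ((p \<circ> e) i))"
        using mono I(1) by (auto simp: strict_mono_on_def)
      ultimately have "forms \<pi> I (p \<circ> e) \<longleftrightarrow> pattern_on u I = \<pi>"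
        unfolding u_def using \<pi>(1) I(2) by (intro forms_iff_pattern_on)
      then show ?thesis
        by (simp add: \<sigma>_def pat_at_pattern_on[OF inj_u I(1)] forms_image)
    qed
    moreover have "card (e ` I) = card I" if "I \<subseteq> {0..<N}" for I
      using that e by (intro card_image) (auto simp: bij_betw_def intro: inj_on_subset)
    ultimately have "bij_betw ((`) e) {I \<in> Pow {0..<N}. card I = length \<pi> \<and> pat_at \<sigma> I = \<pi>}
        {S \<in> Pow {0..<N}. card S = length \<pi> \<and> forms \<pi> S p}"
      by (intro bij_betw_Collect bij_betw_Pow e) auto
    then have "card {I \<in> Pow {0..<N}. card I = length \<pi> \<and> pat_at \<sigma> I = \<pi>} =
        card {S \<in> Pow {0..<N}. card S = length \<pi> \<and> forms \<pi> S p}"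
      by (rule bij_betw_same_card)
    moreover have "{I \<in> windows (real N) (length \<pi>) N. pat_at \<sigma> I = \<pi>} =
        {I \<in> Pow {0..<N}. card I = length \<pi> \<and> pat_at \<sigma> I = \<pi>}"
      using windows_full[OF \<pi>(2)] by auto
    ultimately show ?thesis
      using \<pi>(2) by (simp add: global_density_def rho_def sample_density_def card_windows_full \<sigma>_def)
  qed
  then show ?thesis using is_perm_pattern_on[OF _ inj_u] by (intro that[of \<sigma>]) (simp_all add: \<sigma>_def)
qed

subsection \<open>Independent sampling\<close>

lemma indep_vars_PiM_coordinates:
  assumes "\<And>i. i \<in> I \<Longrightarrow> prob_space (M i)" "I \<noteq> {}"
  shows "prob_space.indep_vars (PiM I M) M (\<lambda>i \<omega>. \<omega> i) I"
proof -
  interpret P: prob_space "PiM I M" by (rule prob_space_PiM[OF assms(1)])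
  show ?thesis
  proof (subst P.indep_vars_iff_distr_eq_PiM')
    have "distr (PiM I M) (PiM I M) (\<lambda>x. \<lambda>i\<in>I. x i) = distr (PiM I M) (PiM I M) (\<lambda>x. x)"
      by (rule distr_cong) (auto simp: space_PiM PiE_def extensional_restrict)
    also have "\<dots> = PiM I M" by (rule distr_id)
    also have "\<dots> = PiM I (\<lambda>i. distr (PiM I M) (M i) (\<lambda>x. x i))"
      using assms(1) by (intro PiM_cong) (auto simp: distr_PiM_component)
    finally show "distr (PiM I M) (PiM I M) (\<lambda>x. \<lambda>i\<in>I. x i) = PiM I (\<lambda>i. distr (PiM I M) (M i) (\<lambda>x. x i))" .
  qed (use assms in auto)
qed

lemma (in prob_space) AE_neq_if_indep_var:
  fixes X Y :: "'a \<Rightarrow> real"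
  assumes indep: "indep_var borel X borel Y" and atomless: "\<And>c. AE \<omega> in M. Y \<omega> \<noteq> c"
  shows "AE \<omega> in M. X \<omega> \<noteq> Y \<omega>"
proof -
  have rv [measurable]: "random_variable borel X" "random_variable borel Y"
    and joint: "distr M borel X \<Otimes>\<^sub>M distr M borel Y = distr M (borel \<Otimes>\<^sub>M borel) (\<lambda>\<omega>. (X \<omega>, Y \<omega>))"
    using indep unfolding indep_var_distribution_eq by auto
  interpret X: prob_space "distr M borel X" by (rule prob_space_distr) measurable
  interpret Y: prob_space "distr M borel Y" by (rule prob_space_distr) measurable
  interpret XY: pair_sigma_finite "distr M borel X" "distr M borel Y" ..
  have "AE z in distr M borel X \<Otimes>\<^sub>M distr M borel Y. fst z \<noteq> snd z"
  proof (rule XY.AE_pair_measure)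
    have "AE y in distr M borel Y. y \<noteq> c" for c
      using atomless by (subst AE_distr_iff) auto
    then show "AE x in distr M borel X. AE y in distr M borel Y. fst (x, y) \<noteq> snd (x, y)"
      by (simp add: eq_commute)
  qed measurable
  then have "AE \<omega> in M. fst (X \<omega>, Y \<omega>) \<noteq> snd (X \<omega>, Y \<omega>)"
    unfolding joint by (rule AE_distrD[rotated]) measurable
  then show ?thesis by simp
qed

lemma (in prob_space) ex_le_expectation:
  fixes f :: "'a \<Rightarrow> real"
  assumes "integrable M f" "AE \<omega> in M. Q \<omega>"
  obtains \<omega> where "Q \<omega>" "f \<omega> \<le> expectation f"
proof (rule ccontr)
  assume "\<not> thesis"
  then have "AE \<omega> in M. expectation f < f \<omega>"
    using assms(2) that by (auto simp: not_le[symmetric] elim!: eventually_mono)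
  then show False using expectation_greater[OF assms(1)] by blast
qed

lemma (in prob_space) centred_indicator_mult:
  fixes p :: real
  assumes A: "A \<in> events" "prob A = p" and B: "B \<in> events" "prob B = p"
  shows "integrable M (\<lambda>\<omega>. (indicator A \<omega> - p) * (indicator B \<omega> - p))"
    and "expectation (\<lambda>\<omega>. (indicator A \<omega> - p) * (indicator B \<omega> - p)) = prob (A \<inter> B) - p\<^sup>2"
proof -
  have expand: "(indicator A \<omega> - p) * (indicator B \<omega> - p) =
      indicator (A \<inter> B) \<omega> - p * indicator A \<omega> - p * indicator B \<omega> + p\<^sup>2" for \<omega>
    by (auto simp: indicator_def power2_eq_square algebra_simps)
  have int: "integrable M (indicator C :: 'a \<Rightarrow> real)" if "C \<in> events" for C
    using that by (intro integrable_real_indicator) (auto simp: emeasure_eq_measure)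
  show "integrable M (\<lambda>\<omega>. (indicator A \<omega> - p) * (indicator B \<omega> - p))"
    unfolding expand using A B int by simp
  show "expectation (\<lambda>\<omega>. (indicator A \<omega> - p) * (indicator B \<omega> - p)) = prob (A \<inter> B) - p\<^sup>2"
    unfolding expand using A B int by (simp add: prob_space power2_eq_square)
qed

lemma (in prob_space) second_moment_frequency_le:
  fixes E :: "'i \<Rightarrow> 'a set" and R :: "'i \<Rightarrow> 'i \<Rightarrow> bool" and p :: real
  assumes I: "finite I" "I \<noteq> {}" and E: "\<And>i. i \<in> I \<Longrightarrow> E i \<in> events" "\<And>i. i \<in> I \<Longrightarrow> prob (E i) = p"
    and uncorrelated: "\<And>i j. i \<in> I \<Longrightarrow> j \<in> I \<Longrightarrow> \<not> R i j \<Longrightarrow> prob (E i \<inter> E j) = p\<^sup>2"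
  defines "freq \<equiv> \<lambda>\<omega>. real (card {i \<in> I. \<omega> \<in> E i}) / real (card I)"
  shows "integrable M (\<lambda>\<omega>. (freq \<omega> - p)\<^sup>2)"
    and "expectation (\<lambda>\<omega>. (freq \<omega> - p)\<^sup>2) \<le> (\<Sum>i\<in>I. real (card {j \<in> I. R i j})) / (real (card I))\<^sup>2"
proof -
  define d where "d i \<omega> = indicator (E i) \<omega> - p" for i \<omega>
  have square: "(freq \<omega> - p)\<^sup>2 = (\<Sum>i\<in>I. \<Sum>j\<in>I. d i \<omega> * d j \<omega>) / (real (card I))\<^sup>2" for \<omega>
  proof -
    have "real (card {i \<in> I. \<omega> \<in> E i}) = (\<Sum>i\<in>I. indicator (E i) \<omega>)"
      using I(1) by (simp add: indicator_def sum.If_cases Int_def)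
    then have "freq \<omega> - p = (\<Sum>i\<in>I. d i \<omega>) / real (card I)"
      using I by (simp add: d_def freq_def sum_subtractf diff_divide_distrib)
    then show ?thesis by (simp add: power_divide power2_eq_square sum_product)
  qed
  have integrable: "integrable M (\<lambda>\<omega>. d i \<omega> * d j \<omega>)" if "i \<in> I" "j \<in> I" for i j
    unfolding d_def using that E by (intro centred_indicator_mult)
  then show "integrable M (\<lambda>\<omega>. (freq \<omega> - p)\<^sup>2)"
    unfolding square by (intro integrable_divide Bochner_Integration.integrable_sum)
  have correlation_le: "expectation (\<lambda>\<omega>. d i \<omega> * d j \<omega>) \<le> of_bool (R i j)" if "i \<in> I" "j \<in> I" for i j
  proof -
    have "expectation (\<lambda>\<omega>. d i \<omega> * d j \<omega>) = prob (E i \<inter> E j) - p\<^sup>2"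
      unfolding d_def using that E by (intro centred_indicator_mult)
    moreover have "prob (E i \<inter> E j) - p\<^sup>2 \<le> 1"
      using prob_le_1[of "E i \<inter> E j"] zero_le_power2[of p] by linarith
    ultimately show ?thesis using uncorrelated[OF that] by auto
  qed
  have "expectation (\<lambda>\<omega>. (freq \<omega> - p)\<^sup>2) =
      (\<Sum>i\<in>I. \<Sum>j\<in>I. expectation (\<lambda>\<omega>. d i \<omega> * d j \<omega>)) / (real (card I))\<^sup>2"
    unfolding square using integrable by (simp add: Bochner_Integration.integral_sum)
  also have "\<dots> \<le> (\<Sum>i\<in>I. \<Sum>j\<in>I. of_bool (R i j)) / (real (card I))\<^sup>2"
    using correlation_le by (intro divide_right_mono sum_mono) auto
  also have "\<dots> = (\<Sum>i\<in>I. real (card {j \<in> I. R i j})) / (real (card I))\<^sup>2"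
    using I(1) by (simp add: of_bool_def sum.If_cases Int_def)
  finally show "expectation (\<lambda>\<omega>. (freq \<omega> - p)\<^sup>2) \<le> (\<Sum>i\<in>I. real (card {j \<in> I. R i j})) / (real (card I))\<^sup>2" .
qed

lemma card_intersecting_subsets_le:
  assumes "finite A" "S \<subseteq> A" "1 \<le> k"
  shows "card {T \<in> Pow A. card T = k \<and> S \<inter> T \<noteq> {}} \<le> card S * ((card A - 1) choose (k - 1))"
proof -
  have fin: "finite S" using assms finite_subset by blast
  have "{T \<in> Pow A. card T = k \<and> S \<inter> T \<noteq> {}} = (\<Union>i\<in>S. {T \<in> Pow A. card T = k \<and> i \<in> T})" by auto
  also have "card \<dots> \<le> (\<Sum>i\<in>S. card {T \<in> Pow A. card T = k \<and> i \<in> T})" by (rule card_UN_le[OF fin])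
  also have "\<dots> = (\<Sum>i\<in>S. (card A - 1) choose (k - 1))"
    using assms by (intro sum.cong refl card_subsets_containing) auto
  finally show ?thesis by simp
qed

lemma proportion_intersecting_subsets_le:
  assumes A: "finite A" and k_bounds: "1 \<le> k" "k \<le> card A"
  defines "\<S> \<equiv> {S \<in> Pow A. card S = k}"
  shows "(\<Sum>S\<in>\<S>. real (card {T \<in> \<S>. S \<inter> T \<noteq> {}})) / (real (card \<S>))\<^sup>2 \<le> (real k)\<^sup>2 / real (card A)"
proof -
  let ?n = "card A"
  let ?C = "real ((?n - 1) choose (k - 1))"
  have card: "card \<S> = ?n choose k" using n_subsets[OF A, of k] by (simp add: \<S>_def)
  have pos: "0 < real (?n choose k)" using k_bounds by simp
  have "(\<Sum>S\<in>\<S>. real (card {T \<in> \<S>. S \<inter> T \<noteq> {}})) \<le> (\<Sum>S\<in>\<S>. real k * ?C)"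
  proof (rule sum_mono)
    fix S assume S: "S \<in> \<S>"
    have "{T \<in> \<S>. S \<inter> T \<noteq> {}} = {T \<in> Pow A. card T = k \<and> S \<inter> T \<noteq> {}}" by (auto simp: \<S>_def)
    then have "card {T \<in> \<S>. S \<inter> T \<noteq> {}} \<le> k * ((?n - 1) choose (k - 1))"
      using card_intersecting_subsets_le[OF A _ k_bounds(1), of S] S by (simp add: \<S>_def)
    then show "real (card {T \<in> \<S>. S \<inter> T \<noteq> {}}) \<le> real k * ?C" by (metis of_nat_le_iff of_nat_mult)
  qed
  then have "(\<Sum>S\<in>\<S>. real (card {T \<in> \<S>. S \<inter> T \<noteq> {}})) / (real (card \<S>))\<^sup>2
      \<le> (\<Sum>S\<in>\<S>. real k * ?C) / (real (card \<S>))\<^sup>2" by (rule divide_right_mono) simp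
  also have "\<dots> = real k * ?C / real (?n choose k)" using pos by (simp add: card power2_eq_square)
  also have "\<dots> = (real k)\<^sup>2 / real ?n"
  proof -
    have "k * (?n choose k) = ?n * ((?n - 1) choose (k - 1))"
      using k_bounds by (intro times_binomial_minus1_eq) auto
    then have "real k * real (?n choose k) = real ?n * ?C" by (metis of_nat_mult)
    then show ?thesis using pos k_bounds by (simp add: power2_eq_square field_simps)
  qed
  finally show ?thesis .
qed

locale plane_distribution = prob_space \<Gamma> for \<Gamma> :: "(real \<times> real) measure" +
  assumes sets_eq_borel: "sets \<Gamma> = sets borel"
    and fst_atomless: "\<And>c. AE v in \<Gamma>. fst v \<noteq> c"
    and snd_atomless: "\<And>c. AE v in \<Gamma>. snd v \<noteq> c"
begin

lemma sets_eq_pair_borel [measurable_cong]: "sets \<Gamma> = sets (borel \<Otimes>\<^sub>M borel)"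
  using sets_eq_borel by (metis borel_prod)

lemma space_eq_UNIV: "space \<Gamma> = UNIV"
  using sets_eq_imp_space_eq[OF sets_eq_borel] by simp

abbreviation samples :: "(nat \<Rightarrow> real \<times> real) measure" where
  "samples \<equiv> PiM UNIV (\<lambda>_. \<Gamma>)"

sublocale samples: prob_space samples
  by (intro prob_space_PiM prob_space_axioms)

lemma indep_var_samples:
  assumes "S \<inter> T = {}"
  shows "samples.indep_var (PiM S (\<lambda>_. \<Gamma>)) (\<lambda>\<omega>. restrict \<omega> S) (PiM T (\<lambda>_. \<Gamma>)) (\<lambda>\<omega>. restrict \<omega> T)"
  using samples.indep_var_restrict[OF indep_vars_PiM_coordinates assms] prob_space_axioms by simp

lemma AE_samples_inj_on:
  fixes h :: "real \<times> real \<Rightarrow> real"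
  assumes h [measurable]: "h \<in> borel_measurable \<Gamma>" and atomless: "\<And>c. AE v in \<Gamma>. h v \<noteq> c"
  shows "AE \<omega> in samples. inj_on (\<lambda>i. h (\<omega> i)) UNIV"
proof -
  have "AE \<omega> in samples. h (\<omega> i) \<noteq> h (\<omega> j)" if "i \<noteq> j" for i j
  proof (rule samples.AE_neq_if_indep_var)
    have eval: "(\<lambda>f. h (f i)) \<in> borel_measurable (PiM {i} (\<lambda>_. \<Gamma>))" for i by measurable
    show "samples.indep_var borel (\<lambda>\<omega>. h (\<omega> i)) borel (\<lambda>\<omega>. h (\<omega> j))"
      using samples.indep_var_compose[OF indep_var_samples eval eval, of i j] that by (simp add: comp_def)
    show "AE \<omega> in samples. h (\<omega> j) \<noteq> c" for c
      using prob_space_axioms by (intro AE_PiM_component atomless) auto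
  qed
  then have "AE \<omega> in samples. \<forall>i j. i \<noteq> j \<longrightarrow> h (\<omega> i) \<noteq> h (\<omega> j)"
    unfolding AE_all_countable by (intro allI AE_impI)
  then show ?thesis by eventually_elim (auto simp: inj_on_def)
qed

lemma measurable_forms:
  assumes "S \<subseteq> A" "finite S"
  shows "Measurable.pred (PiM A (\<lambda>_. \<Gamma>)) (forms \<pi> S)"
proof -
  let ?K = "{..<length \<pi>}"
  let ?Q = "\<lambda>s (p :: nat \<Rightarrow> real \<times> real). \<forall>a\<in>?K. \<forall>b\<in>?K. (a < b \<longrightarrow> fst (p (s a)) < fst (p (s b))) \<and>
    (snd (p (s a)) < snd (p (s b)) \<longleftrightarrow> \<pi> ! a < \<pi> ! b)"
  have forms: "forms \<pi> S = (\<lambda>p. \<exists>s\<in>PiE ?K (\<lambda>_. S). ?Q s p)"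
  proof (intro ext iffI)
    fix p assume "forms \<pi> S p"
    then obtain s where "\<forall>a<length \<pi>. s a \<in> S" "?Q s p" unfolding forms_def by auto
    then show "\<exists>s\<in>PiE ?K (\<lambda>_. S). ?Q s p" by (intro bexI[of _ "restrict s ?K"]) auto
  next
    fix p assume "\<exists>s\<in>PiE ?K (\<lambda>_. S). ?Q s p"
    then obtain s where "s \<in> PiE ?K (\<lambda>_. S)" "?Q s p" by blast
    then show "forms \<pi> S p" unfolding forms_def by (intro exI[of _ s]) (auto dest: PiE_mem)
  qed
  have "Measurable.pred (PiM A (\<lambda>_. \<Gamma>)) (?Q s)" if s: "s \<in> PiE ?K (\<lambda>_. S)" for s
  proof (intro pred_intros_finite(3) finite_lessThan)
    fix a b assume "a \<in> ?K" "b \<in> ?K"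
    then have coord: "(\<lambda>p. p (s a)) \<in> measurable (PiM A (\<lambda>_. \<Gamma>)) \<Gamma>"
        "(\<lambda>p. p (s b)) \<in> measurable (PiM A (\<lambda>_. \<Gamma>)) \<Gamma>"
      using s assms(1) by (auto intro!: measurable_component_singleton dest: PiE_mem)
    have less: "Measurable.pred (PiM A (\<lambda>_. \<Gamma>)) (\<lambda>p. g (p (s a)) < g (p (s b)))"
      if "g \<in> borel_measurable \<Gamma>" for g :: "real \<times> real \<Rightarrow> real"
      unfolding pred_def by (intro borel_measurable_less measurable_compose[OF _ that] coord)
    have "fst \<in> borel_measurable \<Gamma>" "snd \<in> borel_measurable \<Gamma>" by measurable
    note less = this[THEN less]
    show "Measurable.pred (PiM A (\<lambda>_. \<Gamma>)) (\<lambda>p. (a < b \<longrightarrow> fst (p (s a)) < fst (p (s b))) \<and>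
        (snd (p (s a)) < snd (p (s b)) \<longleftrightarrow> \<pi> ! a < \<pi> ! b))"
      using less by (cases "a < b"; cases "\<pi> ! a < \<pi> ! b") simp_all
  qed
  then show ?thesis
    unfolding forms using assms(2) by (intro pred_intros_finite(4) finite_PiE finite_lessThan)
qed

lemma prob_forms:
  assumes S: "finite S" "card S = length \<pi>"
  shows "samples.prob {\<omega> \<in> space samples. forms \<pi> S \<omega>} = permuton_density \<pi> \<Gamma>"
proof -
  let ?K = "{0..<length \<pi>}" and ?xs = "sorted_list_of_set S"
  let ?E = "{p \<in> space (PiM ?K (\<lambda>_. \<Gamma>)). forms \<pi> ?K p}"
  let ?t = "\<lambda>\<omega>. \<lambda>a\<in>?K. \<omega> (?xs ! a) :: real \<times> real"
  have "S = (!) ?xs ` ?K" using S nth_image[of "length \<pi>" ?xs] by simp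
  then have forms: "forms \<pi> S \<omega> \<longleftrightarrow> forms \<pi> ?K (?t \<omega>)" for \<omega>
    using forms_image[of \<pi> "(!) ?xs" ?K \<omega>] forms_cong[of ?K "\<omega> \<circ> (!) ?xs" "?t \<omega>" \<pi>] by simp
  have t: "?t \<in> measurable samples (PiM ?K (\<lambda>_. \<Gamma>))"
    by (intro measurable_restrict measurable_component_singleton) auto
  have "inj_on ((!) ?xs) ?K" using S by (intro inj_on_nth) auto
  then have law: "distr samples (PiM ?K (\<lambda>_. \<Gamma>)) ?t = PiM ?K (\<lambda>_. \<Gamma>)"
    using prob_space_axioms by (intro distr_PiM_reindex) auto
  have "permuton_density \<pi> \<Gamma> = measure (PiM ?K (\<lambda>_. \<Gamma>)) ?E"
    unfolding permuton_density_def pattern_event_eq_forms by (rule arg_cong[of _ _ "measure _"]) auto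
  also have "\<dots> = samples.prob (?t -` ?E \<inter> space samples)"
    using measurable_forms[of ?K ?K \<pi>]
    by (subst law[symmetric], subst measure_distr[OF t]) (auto simp: pred_def)
  also have "?t -` ?E \<inter> space samples = {\<omega> \<in> space samples. forms \<pi> S \<omega>}"
    using measurable_space[OF t] forms by auto
  finally show ?thesis by simp
qed

lemma prob_forms_disjoint:
  assumes S: "finite S" "card S = length \<pi>" and T: "finite T" "card T = length \<pi>" and disjoint: "S \<inter> T = {}"
  shows "samples.prob ({\<omega> \<in> space samples. forms \<pi> S \<omega>} \<inter> {\<omega> \<in> space samples. forms \<pi> T \<omega>}) =
    (permuton_density \<pi> \<Gamma>)\<^sup>2"
proof -
  let ?E = "\<lambda>U. {p \<in> space (PiM U (\<lambda>_. \<Gamma>)). forms \<pi> U p}"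
  have E: "?E U \<in> sets (PiM U (\<lambda>_. \<Gamma>))" if "finite U" for U
    using measurable_forms[of U U \<pi>] that by (simp add: pred_def)
  have preimage: "(\<lambda>\<omega>. restrict \<omega> U) -` ?E U \<inter> space samples = {\<omega> \<in> space samples. forms \<pi> U \<omega>}" for U
    using forms_cong[of U "restrict _ U" _ \<pi>] by (auto simp: space_PiM space_eq_UNIV)
  have "{\<omega> \<in> space samples. forms \<pi> S \<omega>} \<inter> {\<omega> \<in> space samples. forms \<pi> T \<omega>} =
      (\<lambda>\<omega>. (restrict \<omega> S, restrict \<omega> T)) -` (?E S \<times> ?E T) \<inter> space samples"
    unfolding preimage[symmetric] by auto
  also have "samples.prob \<dots> = samples.prob {\<omega> \<in> space samples. forms \<pi> S \<omega>} *
      samples.prob {\<omega> \<in> space samples. forms \<pi> T \<omega>}"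
    unfolding samples.indep_varD[OF indep_var_samples[OF disjoint] E[OF S(1)] E[OF T(1)]] preimage ..
  finally show ?thesis by (simp add: prob_forms S T power2_eq_square)
qed

lemma second_moment_sample_density:
  assumes length_bounds: "1 \<le> length \<pi>" "length \<pi> \<le> N"
  defines "Y \<equiv> \<lambda>\<omega>. (sample_density \<pi> N \<omega> - permuton_density \<pi> \<Gamma>)\<^sup>2"
  shows "integrable samples Y" "samples.expectation Y \<le> (real (length \<pi>))\<^sup>2 / real N"
proof -
  let ?k = "length \<pi>"
  define \<S> where "\<S> = {S \<in> Pow {0..<N}. card S = ?k}"
  define E where "E S = {\<omega> \<in> space samples. forms \<pi> S \<omega>}" for S
  have \<S>: "finite S" "card S = ?k" "S \<subseteq> {0..<N}" if "S \<in> \<S>" for S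
    using that finite_subset by (auto simp: \<S>_def)
  have card_\<S>: "card \<S> = N choose ?k" using n_subsets[of "{0..<N}" ?k] by (simp add: \<S>_def)
  have pos: "0 < N choose ?k" using length_bounds by simp
  have fin: "finite \<S>" "\<S> \<noteq> {}" using card_\<S> pos by (auto intro: card_ge_0_finite)
  have sets: "E S \<in> samples.events" if "S \<in> \<S>" for S
    using measurable_forms[of S UNIV \<pi>] \<S>[OF that] by (simp add: E_def pred_def)
  have prob: "samples.prob (E S) = permuton_density \<pi> \<Gamma>" if "S \<in> \<S>" for S
    using \<S>[OF that] by (simp add: E_def prob_forms)
  have indep: "samples.prob (E S \<inter> E T) = (permuton_density \<pi> \<Gamma>)\<^sup>2"
    if "S \<in> \<S>" "T \<in> \<S>" "\<not> S \<inter> T \<noteq> {}" for S T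
    unfolding E_def using \<S> that by (intro prob_forms_disjoint) auto
  have "{S \<in> \<S>. \<omega> \<in> E S} = {S \<in> Pow {0..<N}. card S = ?k \<and> forms \<pi> S \<omega>}" for \<omega>
    by (auto simp: \<S>_def E_def space_PiM space_eq_UNIV)
  then have Y: "Y = (\<lambda>\<omega>. (real (card {S \<in> \<S>. \<omega> \<in> E S}) / real (card \<S>) - permuton_density \<pi> \<Gamma>)\<^sup>2)"
    by (simp add: Y_def sample_density_def card_\<S>)
  note moment = samples.second_moment_frequency_le[of \<S> E "permuton_density \<pi> \<Gamma>" "\<lambda>S T. S \<inter> T \<noteq> {}",
      OF fin sets prob indep, folded Y]
  show "integrable samples Y" by (rule moment(1))
  have "samples.expectation Y \<le> (\<Sum>S\<in>\<S>. real (card {T \<in> \<S>. S \<inter> T \<noteq> {}})) / (real (card \<S>))\<^sup>2"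
    by (rule moment(2))
  also have "\<dots> \<le> (real ?k)\<^sup>2 / real N"
    using proportion_intersecting_subsets_le[of "{0..<N}" ?k] length_bounds by (simp add: \<S>_def)
  finally show "samples.expectation Y \<le> (real ?k)\<^sup>2 / real N" .
qed

lemma ex_perm_close_to_distribution:
  assumes P: "P \<subseteq> PermS" "\<And>\<pi>. \<pi> \<in> P \<Longrightarrow> length \<pi> \<le> N"
  obtains \<sigma> where "is_perm \<sigma>" "length \<sigma> = N"
    "(\<Sum>\<pi>\<in>P. (global_density \<pi> \<sigma> - permuton_density \<pi> \<Gamma>)\<^sup>2) \<le> (\<Sum>\<pi>\<in>P. (real (length \<pi>))\<^sup>2 / real N)"
proof -
  define Y where "Y \<pi> \<omega> = (sample_density \<pi> N \<omega> - permuton_density \<pi> \<Gamma>)\<^sup>2" for \<pi> \<omega>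
  have Y: "integrable samples (Y \<pi>)" "samples.expectation (Y \<pi>) \<le> (real (length \<pi>))\<^sup>2 / real N"
    if "\<pi> \<in> P" for \<pi>
  proof -
    have "1 \<le> length \<pi>" using that P(1) by (auto simp: PermS_def)
    then show "integrable samples (Y \<pi>)" "samples.expectation (Y \<pi>) \<le> (real (length \<pi>))\<^sup>2 / real N"
      unfolding Y_def using P(2)[OF that] by (rule second_moment_sample_density)+
  qed
  have "AE \<omega> in samples. inj_on (\<lambda>i. fst (\<omega> i)) UNIV" "AE \<omega> in samples. inj_on (\<lambda>i. snd (\<omega> i)) UNIV"
    using fst_atomless snd_atomless by (auto intro!: AE_samples_inj_on)
  then have distinct: "AE \<omega> in samples. inj_on (\<lambda>i. fst (\<omega> i)) {0..<N} \<and> inj_on (\<lambda>i. snd (\<omega> i)) {0..<N}"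
    by eventually_elim (auto intro: inj_on_subset)
  have "integrable samples (\<lambda>\<omega>. \<Sum>\<pi>\<in>P. Y \<pi> \<omega>)" using Y(1) by (rule Bochner_Integration.integrable_sum)
  from samples.ex_le_expectation[OF this distinct]
  obtain \<omega> where \<omega>: "inj_on (\<lambda>i. fst (\<omega> i)) {0..<N}" "inj_on (\<lambda>i. snd (\<omega> i)) {0..<N}"
    and small: "(\<Sum>\<pi>\<in>P. Y \<pi> \<omega>) \<le> samples.expectation (\<lambda>\<omega>. \<Sum>\<pi>\<in>P. Y \<pi> \<omega>)"
    by blast
  obtain \<sigma> where \<sigma>: "is_perm \<sigma>" "length \<sigma> = N"
    "\<And>\<pi>. \<pi> \<in> PermS \<Longrightarrow> global_density \<pi> \<sigma> = sample_density \<pi> N \<omega>"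
    using ex_perm_of_points[OF \<omega>] by blast
  have "(\<Sum>\<pi>\<in>P. (global_density \<pi> \<sigma> - permuton_density \<pi> \<Gamma>)\<^sup>2) = (\<Sum>\<pi>\<in>P. Y \<pi> \<omega>)"
    using \<sigma>(3) P(1) by (intro sum.cong) (auto simp: Y_def)
  also note small
  also have "samples.expectation (\<lambda>\<omega>. \<Sum>\<pi>\<in>P. Y \<pi> \<omega>) = (\<Sum>\<pi>\<in>P. samples.expectation (Y \<pi>))"
    using Y(1) by (rule Bochner_Integration.integral_sum)
  also have "\<dots> \<le> (\<Sum>\<pi>\<in>P. (real (length \<pi>))\<^sup>2 / real N)" using Y(2) by (rule sum_mono)
  finally show ?thesis using \<sigma>(1,2) that by blast
qed

lemma ex_perm_sequence_converging:
  assumes P: "finite P" "P \<subseteq> PermS"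
  obtains s where "\<And>N. is_perm (s N)" "\<And>N. length (s N) = N"
    "\<And>\<pi>. \<pi> \<in> P \<Longrightarrow> (\<lambda>N. global_density \<pi> (s N)) \<longlonglongrightarrow> permuton_density \<pi> \<Gamma>"
proof -
  define err where "err \<sigma> = (\<Sum>\<pi>\<in>P. (global_density \<pi> \<sigma> - permuton_density \<pi> \<Gamma>)\<^sup>2)" for \<sigma>
  define bound where "bound N = (\<Sum>\<pi>\<in>P. (real (length \<pi>))\<^sup>2 / real N)" for N
  have "\<exists>\<sigma>. is_perm \<sigma> \<and> length \<sigma> = N \<and> ((\<forall>\<pi>\<in>P. length \<pi> \<le> N) \<longrightarrow> err \<sigma> \<le> bound N)" for N
  proof (cases "\<forall>\<pi>\<in>P. length \<pi> \<le> N")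
    case True
    then show ?thesis using ex_perm_close_to_distribution[OF P(2), of N] by (metis err_def bound_def)
  next
    case False
    have "is_perm [0..<N]" by (simp add: is_perm_def)
    then show ?thesis using False by (intro exI[of _ "[0..<N]"]) auto
  qed
  then obtain s where s: "\<And>N. is_perm (s N)" "\<And>N. length (s N) = N"
    "\<And>N. \<forall>\<pi>\<in>P. length \<pi> \<le> N \<Longrightarrow> err (s N) \<le> bound N" by metis
  have "\<forall>\<^sub>F N in sequentially. \<forall>\<pi>\<in>P. length \<pi> \<le> N"
    using P(1) by (intro eventually_ball_finite ballI eventually_ge_at_top)
  then have err_le: "\<forall>\<^sub>F N in sequentially. err (s N) \<le> bound N"
    by (rule eventually_mono) (rule s(3))
  have "bound \<longlonglongrightarrow> (\<Sum>\<pi>\<in>P. (real (length \<pi>))\<^sup>2 * 0)"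
    unfolding bound_def divide_inverse by (intro tendsto_intros lim_inverse_n)
  then have "bound \<longlonglongrightarrow> 0" by simp
  have "(\<lambda>N. global_density \<pi> (s N)) \<longlonglongrightarrow> permuton_density \<pi> \<Gamma>" if "\<pi> \<in> P" for \<pi>
  proof -
    have "(global_density \<pi> (s N) - permuton_density \<pi> \<Gamma>)\<^sup>2 \<le> err (s N)" for N
      unfolding err_def using that P(1) by (intro member_le_sum) auto
    then have "(\<lambda>N. (global_density \<pi> (s N) - permuton_density \<pi> \<Gamma>)\<^sup>2) \<longlonglongrightarrow> 0"
      using err_le by (intro tendsto_sandwich[OF _ _ tendsto_const \<open>bound \<longlonglongrightarrow> 0\<close>])
        (auto elim!: eventually_mono intro: order_trans)
    then show ?thesis by (simp add: power_tendsto_0_iff LIM_zero_iff)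
  qed
  then show ?thesis using that s(1,2) by blast
qed

end

lemma plane_distribution_permuton:
  assumes "permuton \<Gamma>"
  shows "plane_distribution \<Gamma>"
proof -
  interpret prob_space \<Gamma> using assms by (simp add: permuton_def)
  have [measurable_cong]: "sets \<Gamma> = sets (borel \<Otimes>\<^sub>M borel)"
    using assms unfolding permuton_def by (metis borel_prod)
  have "AE x in uniform_measure lborel {0..1::real}. x \<noteq> c" for c
    using AE_lborel_singleton[of c] by (intro AE_uniform_measureI) (auto elim: eventually_mono)
  then have "AE x in distr \<Gamma> borel fst. x \<noteq> c" "AE x in distr \<Gamma> borel snd. x \<noteq> c" for c
    using assms unfolding permuton_def by metis+
  then have "AE v in \<Gamma>. fst v \<noteq> c" "AE v in \<Gamma>. snd v \<noteq> c" for c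
    by (auto intro: AE_distrD[of fst \<Gamma> borel] AE_distrD[of snd \<Gamma> borel])
  then show ?thesis using assms by unfold_locales (auto simp: permuton_def)
qed

subsection \<open>Densities at a scale\<close>

definition scale_density :: "real \<Rightarrow> nat list \<Rightarrow> nat list \<Rightarrow> real" where
  "scale_density x \<pi> \<sigma> = rho (max (real (length \<pi>)) x) \<pi> \<sigma>"

definition densities_converge ::
    "(nat \<Rightarrow> real) \<Rightarrow> (nat \<Rightarrow> nat list) \<Rightarrow> (nat list \<Rightarrow> real) \<Rightarrow> bool" where
  "densities_converge F \<sigma> \<Xi> \<longleftrightarrow>
     (\<forall>\<pi>\<in>PermS. (\<lambda>j. scale_density (F (length (\<sigma> j))) \<pi> (\<sigma> j)) \<longlonglongrightarrow> \<Xi> \<pi>)"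

lemma PermS_length: "\<pi> \<in> PermS \<Longrightarrow> 1 \<le> length \<pi>"
  by (simp add: PermS_def)

lemma local_density_eq_scale_density: "1 \<le> length \<pi> \<Longrightarrow> local_density \<pi> \<sigma> = scale_density 1 \<pi> \<sigma>"
  by (simp add: local_density_def scale_density_def max_absorb1)

lemma converges_locally_iff: "converges_locally \<sigma> \<Lambda> \<longleftrightarrow> densities_converge (\<lambda>_. 1) \<sigma> \<Lambda>"
  unfolding converges_locally_def densities_converge_def
  using local_density_eq_scale_density PermS_length by (intro ball_cong refl) presburger

lemma converges_at_scale_iff:
  assumes "perm_sequence \<sigma>" "filterlim f at_top sequentially"
  shows "converges_at_scale f \<sigma> \<Xi> \<longleftrightarrow> densities_converge f \<sigma> \<Xi>"
  unfolding converges_at_scale_def densities_converge_def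
proof (intro ball_cong refl tendsto_cong)
  fix \<pi> :: "nat list"
  have "filterlim (\<lambda>j. f (length (\<sigma> j))) at_top sequentially"
    using assms by (auto simp: perm_sequence_def intro: filterlim_compose)
  then have "\<forall>\<^sub>F j in sequentially. real (length \<pi>) \<le> f (length (\<sigma> j))"
    by (simp add: filterlim_at_top)
  then show "\<forall>\<^sub>F j in sequentially.
      rho (f (length (\<sigma> j))) \<pi> (\<sigma> j) = scale_density (f (length (\<sigma> j))) \<pi> (\<sigma> j)"
    by eventually_elim (simp add: scale_density_def max_absorb2)
qed

lemma converges_globally_iff:
  assumes "perm_sequence \<sigma>"
  shows "converges_globally \<sigma> \<Gamma> \<longleftrightarrow> densities_converge real \<sigma> (\<lambda>\<pi>. permuton_density \<pi> \<Gamma>)"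
  using converges_at_scale_iff[OF assms filterlim_real_sequentially]
  by (simp add: converges_globally_def converges_at_scale_def global_density_def)

subsection \<open>Levels\<close>

datatype level = Level (level_scale: "nat \<Rightarrow> real") (model: "nat list") (model_scale: real)

definition level_block :: "level \<Rightarrow> nat \<Rightarrow> nat" where
  "level_block l = block (level_scale l) (model_scale l)"

definition proper_level :: "level \<Rightarrow> bool" where
  "proper_level l \<longleftrightarrow> is_perm (model l) \<and> model l \<noteq> [] \<and> 1 \<le> model_scale l \<and>
     (\<forall>\<^sub>F n in sequentially. model_scale l \<le> level_scale l n)"

text \<open>All but a proportion \<open>\<epsilon>\<close> of the windows are lifted from windows of the model.\<close>

definition covered :: "nat \<Rightarrow> real \<Rightarrow> level \<Rightarrow> bool" where
  "covered k \<epsilon> l \<longleftrightarrow> (\<exists>q. \<forall>\<^sub>F n in sequentially.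
     max (real k) (model_scale l) * real (level_block l n) \<le> max (real k) (level_scale l n) \<and>
     q n * length (model l) * level_block l n \<le> n \<and>
     (1 - \<epsilon>) * real (card (scale_windows (level_scale l n) k n)) \<le>
       real (q n * card (scale_windows (model_scale l) k (length (model l))) * level_block l n ^ k))"

definition approximates :: "nat list set \<Rightarrow> real \<Rightarrow> (nat list \<Rightarrow> real) \<Rightarrow> level \<Rightarrow> bool" where
  "approximates P \<epsilon> \<Xi> l \<longleftrightarrow>
     (\<forall>\<pi>\<in>P. \<bar>scale_density (model_scale l) \<pi> (model l) - \<Xi> \<pi>\<bar> \<le> \<epsilon> \<and> covered (length \<pi>) \<epsilon> l)"

definition approximable :: "(nat \<Rightarrow> real) \<Rightarrow> (nat list \<Rightarrow> real) \<Rightarrow> bool" where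
  "approximable F \<Xi> \<longleftrightarrow> (\<forall>P \<epsilon>. finite P \<longrightarrow> P \<subseteq> PermS \<longrightarrow> 0 < \<epsilon> \<longrightarrow>
     (\<exists>l. level_scale l = F \<and> proper_level l \<and> approximates P \<epsilon> \<Xi> l))"

lemma ex_level_approximating:
  fixes c :: "nat \<Rightarrow> real"
  assumes P: "finite P" "P \<subseteq> PermS" and eps_pos: "0 < \<epsilon>"
    and models: "\<forall>\<^sub>F j in sequentially. is_perm (s j) \<and> s j \<noteq> [] \<and> 1 \<le> w j"
    and F_unbounded: "\<And>x. x = 1 \<or> x \<in> range w \<Longrightarrow> \<forall>\<^sub>F n in sequentially. x \<le> F n"
    and density: "\<And>\<pi>. \<pi> \<in> P \<Longrightarrow> (\<lambda>j. scale_density (w j) \<pi> (s j)) \<longlonglongrightarrow> \<Xi> \<pi>"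
    and c_pos: "\<And>k. 0 < c k"
    and count: "\<And>k. 1 \<le> k \<Longrightarrow> (\<lambda>n. normalized_count k (F n) n) \<longlonglongrightarrow> c k"
    and model_count: "\<And>k. 1 \<le> k \<Longrightarrow> (\<lambda>j. normalized_count k (w j) (length (s j))) \<longlonglongrightarrow> c k"
    and tiles: "\<And>k. 1 \<le> k \<Longrightarrow> \<forall>\<^sub>F j in sequentially. tiles k F (w j) (length (s j))"
  shows "\<exists>l. level_scale l = F \<and> proper_level l \<and> approximates P \<epsilon> \<Xi> l"
proof -
  have "\<forall>\<^sub>F j in sequentially. \<forall>\<pi>\<in>P. \<bar>scale_density (w j) \<pi> (s j) - \<Xi> \<pi>\<bar> \<le> \<epsilon> \<and>
      covered (length \<pi>) \<epsilon> (Level F (s j) (w j))"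
  proof (intro eventually_ball_finite ballI eventually_conj P(1))
    fix \<pi> assume \<pi>: "\<pi> \<in> P"
    show "\<forall>\<^sub>F j in sequentially. \<bar>scale_density (w j) \<pi> (s j) - \<Xi> \<pi>\<bar> \<le> \<epsilon>"
      using tendstoD[OF density[OF \<pi>] eps_pos] by eventually_elim (simp add: dist_real_def)
    have k_ge_1: "1 \<le> length \<pi>" using \<pi> P(2) PermS_length by blast
    have "(1 - \<epsilon>) * c (length \<pi>) < c (length \<pi>)" using eps_pos c_pos by simp
    from order_tendstoD(1)[OF model_count[OF k_ge_1] this] tiles[OF k_ge_1]
    show "\<forall>\<^sub>F j in sequentially. covered (length \<pi>) \<epsilon> (Level F (s j) (w j))"
    proof eventually_elim
      case (elim j)
      have "\<forall>\<^sub>F n in sequentially. 0 < F n" using F_unbounded[of 1] by (auto elim: eventually_mono)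
      then show ?case
        using eventually_covered_by_lifts[OF elim(2) k_ge_1 _ count[OF k_ge_1] elim(1)]
        unfolding covered_def level_block_def level.sel by metis
    qed
  qed
  from eventually_happens'[OF sequentially_bot eventually_conj[OF this models]]
  obtain j where "approximates P \<epsilon> \<Xi> (Level F (s j) (w j))" "is_perm (s j)" "s j \<noteq> []" "1 \<le> w j"
    by (auto simp: approximates_def)
  then show ?thesis
    using F_unbounded by (intro exI[of _ "Level F (s j) (w j)"]) (simp add: proper_level_def)
qed

lemma perm_sequence_eventually_nonempty:
  assumes "perm_sequence s"
  shows "\<forall>\<^sub>F j in sequentially. is_perm (s j) \<and> s j \<noteq> []"
proof -
  have "\<forall>\<^sub>F j in sequentially. 1 \<le> length (s j)"
    using assms by (simp add: perm_sequence_def filterlim_at_top)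
  then show ?thesis using assms by (auto simp: perm_sequence_def elim!: eventually_mono)
qed

lemma approximable_local_limit:
  assumes "perm_local_limit \<Lambda>"
  shows "approximable (\<lambda>_. 1) \<Lambda>"
  unfolding approximable_def
proof (intro allI impI)
  fix P :: "nat list set" and \<epsilon> :: real assume P: "finite P" "P \<subseteq> PermS" and eps_pos: "0 < \<epsilon>"
  obtain s where s: "perm_sequence s" and lim: "densities_converge (\<lambda>_. 1) s \<Lambda>"
    using assms by (auto simp: perm_local_limit_def converges_locally_iff)
  note nonempty = perm_sequence_eventually_nonempty[OF s]
  show "\<exists>l. level_scale l = (\<lambda>_. 1) \<and> proper_level l \<and> approximates P \<epsilon> \<Lambda> l"
  proof (rule ex_level_approximating[OF P eps_pos, where s = s and w = "\<lambda>_. 1" and c = "\<lambda>_. 1"])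
    fix k :: nat assume k_ge_1: "1 \<le> k"
    show "(\<lambda>n. normalized_count k 1 n) \<longlonglongrightarrow> 1" by (rule tendsto_normalized_count_const[OF k_ge_1])
    then show "(\<lambda>j. normalized_count k 1 (length (s j))) \<longlonglongrightarrow> 1"
      using s by (auto simp: perm_sequence_def intro: filterlim_compose)
    show "\<forall>\<^sub>F j in sequentially. tiles k (\<lambda>_. 1) 1 (length (s j))"
      using nonempty by eventually_elim (simp add: tiles_const[OF k_ge_1])
  qed (use nonempty lim P(2) in \<open>auto simp: densities_converge_def\<close>)
qed

lemma approximable_scale_limit:
  assumes \<Xi>: "scale_limit \<Xi>" and f: "scaling_function f"
  shows "approximable f \<Xi>"
  unfolding approximable_def
proof (intro allI impI)
  fix P :: "nat list set" and \<epsilon> :: real assume P: "finite P" "P \<subseteq> PermS" and eps_pos: "0 < \<epsilon>"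
  obtain g s where g: "scaling_function g" and s: "perm_sequence s" and lim: "converges_at_scale g s \<Xi>"
    using \<Xi> by (auto simp: scale_limit_def)
  have top: "filterlim f at_top sequentially" "filterlim g at_top sequentially"
    and sublinear: "(\<lambda>n. f n / real n) \<longlonglongrightarrow> 0" "(\<lambda>n. g n / real n) \<longlonglongrightarrow> 0"
    using scaling_functionD[OF f] scaling_functionD[OF g] by (simp_all add: dominated_def)
  define w where "w j = g (length (s j))" for j
  have len: "filterlim (\<lambda>j. length (s j)) at_top sequentially" using s by (simp add: perm_sequence_def)
  have w_top: "filterlim w at_top sequentially"
    unfolding w_def by (rule filterlim_compose[OF top(2) len])
  have w_sublinear: "(\<lambda>j. w j / real (length (s j))) \<longlonglongrightarrow> 0"
    unfolding w_def by (rule filterlim_compose[OF sublinear(2) len])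
  have w_ge: "\<forall>\<^sub>F j in sequentially. x \<le> w j" for x using w_top by (simp add: filterlim_at_top)
  note nonempty = perm_sequence_eventually_nonempty[OF s]
  show "\<exists>l. level_scale l = f \<and> proper_level l \<and> approximates P \<epsilon> \<Xi> l"
  proof (rule ex_level_approximating[OF P eps_pos, where s = s and w = w and c = "\<lambda>k. 1 / fact (k - 1)"])
    show "\<forall>\<^sub>F j in sequentially. is_perm (s j) \<and> s j \<noteq> [] \<and> 1 \<le> w j"
      using nonempty w_ge[of 1] by eventually_elim simp
    show "\<forall>\<^sub>F n in sequentially. x \<le> f n" for x using top(1) by (simp add: filterlim_at_top)
    show "(\<lambda>j. scale_density (w j) \<pi> (s j)) \<longlonglongrightarrow> \<Xi> \<pi>" if "\<pi> \<in> P" for \<pi>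
      using lim that P(2) unfolding converges_at_scale_iff[OF s top(2)]
      by (auto simp: densities_converge_def w_def)
    fix k :: nat assume k_ge_1: "1 \<le> k"
    show "(\<lambda>n. normalized_count k (f n) n) \<longlonglongrightarrow> 1 / fact (k - 1)"
      by (rule tendsto_normalized_count_sublinear[OF k_ge_1 top(1) eventually_gt_at_top sublinear(1)])
    show "(\<lambda>j. normalized_count k (w j) (length (s j))) \<longlonglongrightarrow> 1 / fact (k - 1)"
      using nonempty
      by (intro tendsto_normalized_count_sublinear k_ge_1 w_top w_sublinear) (auto elim: eventually_mono)
    show "\<forall>\<^sub>F j in sequentially. tiles k f (w j) (length (s j))"
      using w_ge[of "real k"] nonempty by eventually_elim (use f k_ge_1 in \<open>auto intro!: tiles_scaling\<close>)
  qed simp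
qed

lemma approximable_permuton:
  assumes "permuton \<Gamma>"
  shows "approximable real (\<lambda>\<pi>. permuton_density \<pi> \<Gamma>)"
  unfolding approximable_def
proof (intro allI impI)
  fix P :: "nat list set" and \<epsilon> :: real assume P: "finite P" "P \<subseteq> PermS" and eps_pos: "0 < \<epsilon>"
  obtain s where s: "\<And>N. is_perm (s N)" "\<And>N. length (s N) = N"
    and lim: "\<And>\<pi>. \<pi> \<in> P \<Longrightarrow> (\<lambda>N. global_density \<pi> (s N)) \<longlonglongrightarrow> permuton_density \<pi> \<Gamma>"
    using plane_distribution.ex_perm_sequence_converging[OF plane_distribution_permuton[OF assms] P]
    by blast
  show "\<exists>l. level_scale l = real \<and> proper_level l \<and> approximates P \<epsilon> (\<lambda>\<pi>. permuton_density \<pi> \<Gamma>) l"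
  proof (rule ex_level_approximating[OF P eps_pos, where s = s and w = real and c = "\<lambda>k. 1 / fact k"])
    show "\<forall>\<^sub>F N in sequentially. is_perm (s N) \<and> s N \<noteq> [] \<and> 1 \<le> real N"
      using eventually_ge_at_top[of 1] by eventually_elim (use s in \<open>force simp flip: length_0_conv\<close>)
    show "\<forall>\<^sub>F n in sequentially. x \<le> real n" for x
      using filterlim_real_sequentially by (simp add: filterlim_at_top)
    show "(\<lambda>N. scale_density (real N) \<pi> (s N)) \<longlonglongrightarrow> permuton_density \<pi> \<Gamma>" if "\<pi> \<in> P" for \<pi>
    proof (rule Lim_transform_eventually[OF lim[OF that]])
      show "\<forall>\<^sub>F N in sequentially. global_density \<pi> (s N) = scale_density (real N) \<pi> (s N)"
        using eventually_ge_at_top[of "length \<pi>"]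
        by eventually_elim (simp add: global_density_def scale_density_def s(2) max_absorb2)
    qed
    fix k :: nat assume k_ge_1: "1 \<le> k"
    show "(\<lambda>n. normalized_count k (real n) n) \<longlonglongrightarrow> 1 / fact k"
      by (rule tendsto_normalized_count_full[OF k_ge_1])
    then show "(\<lambda>N. normalized_count k (real N) (length (s N))) \<longlonglongrightarrow> 1 / fact k" by (simp add: s(2))
    show "\<forall>\<^sub>F N in sequentially. tiles k real (real N) (length (s N))"
      using eventually_ge_at_top[of k] by eventually_elim (use k_ge_1 in \<open>simp add: s(2) tiles_full\<close>)
  qed simp
qed

subsection \<open>Hierarchies of levels\<close>

lemma append_Cons_less_iff:
  fixes a b :: "'a::linorder"
  shows "us @ a # vs < us @ b # ws \<longleftrightarrow> a < b \<or> a = b \<and> vs < ws"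
  by (induction us) auto

lemma pattern_on_lexicographic:
  fixes key :: "'b \<Rightarrow> nat \<Rightarrow> 'a::linorder"
  assumes tied: "\<And>h i j. h \<in> set coarser \<Longrightarrow> i \<in> I \<Longrightarrow> j \<in> I \<Longrightarrow> key h i = key h j"
    and inj: "inj_on (key l) I"
  shows "pattern_on (\<lambda>i. map (\<lambda>h. key h i) (coarser @ l # finer)) I = pattern_on (key l) I"
proof (rule pattern_on_cong)
  fix i j assume ij: "i \<in> I" "j \<in> I"
  then have tie: "map (\<lambda>h. key h i) coarser = map (\<lambda>h. key h j) coarser"
    by (intro map_cong refl tied)
  have "\<not> map (\<lambda>h. key h i) finer < map (\<lambda>h. key h j) finer" if "key l i = key l j"
    using inj_onD[OF inj that ij] by simp
  then show "map (\<lambda>h. key h i) (coarser @ l # finer) < map (\<lambda>h. key h j) (coarser @ l # finer) \<longleftrightarrow>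
      key l i < key l j"
    unfolding map_append list.map tie append_Cons_less_iff by blast
qed

definition level_key :: "nat \<Rightarrow> level \<Rightarrow> nat \<Rightarrow> nat" where
  "level_key n l = inflation (level_block l n) (model l)"

definition level_keys :: "nat \<Rightarrow> level list \<Rightarrow> nat \<Rightarrow> nat list" where
  "level_keys n levels i = map (\<lambda>l. level_key n l i) levels"

definition level_perm :: "level list \<Rightarrow> nat \<Rightarrow> nat list" where
  "level_perm levels n = pattern_on (level_keys n levels) {0..<n}"

definition crossing_any :: "level list \<Rightarrow> nat \<Rightarrow> nat set set" where
  "crossing_any levels n = (\<Union>l\<in>set levels. crossing (level_block l n))"

lemma length_level_perm [simp]: "length (level_perm levels n) = n"
  by (simp add: level_perm_def)

lemma tendsto_width_over_level_block:
  assumes dom: "dominated F (level_scale l)" and F_ge_1: "\<forall>\<^sub>F n in sequentially. 1 \<le> F n"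
    and l: "proper_level l" and k_ge_1: "1 \<le> k"
  shows "(\<lambda>n. max (real k) (F n) / real (level_block l n)) \<longlonglongrightarrow> 0"
proof (rule tendsto_sandwich[OF _ _ tendsto_const])
  have w_pos: "0 < model_scale l" and level_scale_ge_1: "\<forall>\<^sub>F n in sequentially. 1 \<le> level_scale l n"
    using l by (auto simp: proper_level_def elim: eventually_mono)
  have ratio: "(\<lambda>n. real (level_block l n) / level_scale l n) \<longlonglongrightarrow> 1 / model_scale l"
    unfolding level_block_def
    by (rule tendsto_block_ratio[OF w_pos filterlim_at_top_if_dominates[OF dom F_ge_1 level_scale_ge_1]])
  have "(\<lambda>n. real k * ((F n / level_scale l n) / (real (level_block l n) / level_scale l n))) \<longlonglongrightarrow>
      real k * (0 / (1 / model_scale l))"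
    using dom w_pos unfolding dominated_def
    by (intro tendsto_mult[OF tendsto_const] tendsto_divide[OF _ ratio]) auto
  then show "(\<lambda>n. real k * ((F n / level_scale l n) / (real (level_block l n) / level_scale l n))) \<longlonglongrightarrow> 0"
    by simp
  show "\<forall>\<^sub>F n in sequentially. max (real k) (F n) / real (level_block l n) \<le>
      real k * ((F n / level_scale l n) / (real (level_block l n) / level_scale l n))"
    using F_ge_1 level_scale_ge_1
  proof eventually_elim
    case (elim n)
    have "max (real k) (F n) \<le> real k * F n"
      using mult_left_mono[OF elim(1), of "real k"] mult_right_mono[of 1 "real k" "F n"] elim(1) k_ge_1
      by simp
    then show ?case using elim by (simp add: divide_right_mono)
  qed
qed auto

lemma inj_level_key:
  assumes "proper_level l" "level_block l n = 1"
  shows "inj (level_key n l)"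
  using inj_infinite_direct_sum[of "model l"] assms
  by (simp add: level_key_def inflation_def proper_level_def comp_def)

lemma eventually_level_block_pos:
  assumes "proper_level l"
  shows "\<forall>\<^sub>F n in sequentially. 0 < level_block l n"
proof -
  have "0 < model_scale l" "\<forall>\<^sub>F n in sequentially. model_scale l \<le> level_scale l n"
    using assms by (auto simp: proper_level_def)
  from this(2) show ?thesis
    by eventually_elim (use \<open>0 < model_scale l\<close> in \<open>simp add: level_block_def block_def\<close>)
qed

locale level_hierarchy =
  fixes levels :: "level list"
  assumes proper: "l \<in> set levels \<Longrightarrow> proper_level l"
    and scale_le: "l \<in> set levels \<Longrightarrow> \<forall>\<^sub>F n in sequentially. level_scale l n \<le> real n"
    and sorted_by_domination: "sorted_wrt (\<lambda>l l'. dominated (level_scale l') (level_scale l)) levels"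
    and finest: "\<exists>l\<in>set levels. level_scale l = (\<lambda>_. 1)"
begin

lemma eventually_scale_ge_1: "l \<in> set levels \<Longrightarrow> \<forall>\<^sub>F n in sequentially. 1 \<le> level_scale l n"
  using proper by (force simp: proper_level_def elim: eventually_mono)

lemma eventually_level_block_le:
  assumes "l \<in> set levels"
  shows "\<forall>\<^sub>F n in sequentially. level_block l n \<le> n"
  using eventually_scale_ge_1[OF assms] scale_le[OF assms]
proof eventually_elim
  case (elim n)
  have w_ge_1: "1 \<le> model_scale l" using proper[OF assms] by (simp add: proper_level_def)
  then have "real (level_block l n) \<le> level_scale l n / model_scale l"
    unfolding level_block_def using elim by (intro block_le) auto
  also have "\<dots> \<le> level_scale l n / 1" using w_ge_1 elim by (intro divide_left_mono) auto
  finally show ?case using elim by simp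
qed

lemma inj_level_keys: "inj (level_keys n levels)"
proof -
  obtain l where l: "l \<in> set levels" "level_scale l = (\<lambda>_. 1)" using finest by blast
  then have "model_scale l = 1" using proper[OF l(1)] by (simp add: proper_level_def)
  then have "inj (level_key n l)"
    using l proper by (intro inj_level_key) (auto simp: level_block_def block_def)
  moreover have "level_key n l i = level_key n l j"
    if "level_keys n levels i = level_keys n levels j" for i j
    using that l(1) by (simp add: level_keys_def)
  ultimately show ?thesis unfolding inj_def by blast
qed

lemma is_perm_level_perm: "is_perm (level_perm levels n)"
  unfolding level_perm_def using inj_level_keys by (intro is_perm_pattern_on) (auto intro: inj_on_subset)

lemma pat_at_level_perm:
  assumes levels: "levels = coarser @ l # finer" and I: "I \<subseteq> {0..<n}" "inj_on (level_key n l) I"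
    and inside: "I \<notin> crossing_any coarser n"
  shows "pat_at (level_perm levels n) I = pattern_on (level_key n l) I"
proof -
  have "level_key n l' i = level_key n l' j" if "l' \<in> set coarser" "i \<in> I" "j \<in> I" for l' i j
    using same_block_if_not_crossing[of I "level_block l' n" i j] that inside finite_subset[OF I(1)]
    by (simp add: crossing_any_def level_key_def inflation_def)
  then have "pattern_on (level_keys n levels) I = pattern_on (level_key n l) I"
    unfolding levels level_keys_def using I(2) by (intro pattern_on_lexicographic)
  then show ?thesis
    unfolding level_perm_def using I(1) inj_level_keys
    by (subst pat_at_pattern_on) (auto intro: inj_on_subset)
qed

lemma tendsto_coarse_crossing_ratio:
  assumes levels: "levels = coarser @ l # finer" and k_ge_1: "1 \<le> k"
  defines "W \<equiv> \<lambda>n. scale_windows (level_scale l n) k n"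
  shows "(\<lambda>n. real (card (W n \<inter> crossing_any coarser n)) / real (card (W n))) \<longlonglongrightarrow> 0"
proof (rule tendsto_sandwich[OF _ _ tendsto_const])
  have "(\<lambda>n. real (card (W n \<inter> crossing (level_block l' n))) / real (card (W n))) \<longlonglongrightarrow> 0"
    if l': "l' \<in> set coarser" for l'
    unfolding W_def
  proof (rule tendsto_crossing_ratio[OF k_ge_1])
    have in_levels: "l \<in> set levels" "l' \<in> set levels" using l' by (auto simp: levels)
    show "\<forall>\<^sub>F n in sequentially. 1 \<le> max (real k) (level_scale l n)"
      using k_ge_1 by (intro always_eventually allI) simp
    show "(\<lambda>n. max (real k) (level_scale l n) / real (level_block l' n)) \<longlonglongrightarrow> 0"
      using sorted_by_domination l' in_levels
      by (intro tendsto_width_over_level_block eventually_scale_ge_1 proper k_ge_1)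
        (auto simp: levels sorted_wrt_append)
    show "\<forall>\<^sub>F n in sequentially. 0 < level_block l' n \<and> level_block l' n \<le> n"
      using eventually_level_block_pos[OF proper] eventually_level_block_le in_levels(2)
      by (simp add: eventually_conj)
  qed
  then have "(\<lambda>n. \<Sum>l'\<in>set coarser. real (card (W n \<inter> crossing (level_block l' n))) / real (card (W n)))
      \<longlonglongrightarrow> (\<Sum>l'\<in>set coarser. 0)"
    by (rule tendsto_sum)
  then show "(\<lambda>n. \<Sum>l'\<in>set coarser. real (card (W n \<inter> crossing (level_block l' n))) / real (card (W n))) \<longlonglongrightarrow> 0"
    by simp
  have "card (W n \<inter> crossing_any coarser n)
      \<le> (\<Sum>l'\<in>set coarser. card (W n \<inter> crossing (level_block l' n)))" for n
    unfolding crossing_any_def Int_UN_distrib by (rule card_UN_le) simp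
  then have "real (card (W n \<inter> crossing_any coarser n))
      \<le> (\<Sum>l'\<in>set coarser. real (card (W n \<inter> crossing (level_block l' n))))" for n
    by (metis of_nat_mono of_nat_sum)
  then show "\<forall>\<^sub>F n in sequentially. real (card (W n \<inter> crossing_any coarser n)) / real (card (W n))
      \<le> (\<Sum>l'\<in>set coarser. real (card (W n \<inter> crossing (level_block l' n))) / real (card (W n)))"
    unfolding sum_divide_distrib[symmetric] by (intro always_eventually allI divide_right_mono) auto
qed auto

lemma eventually_level_perm_density:
  assumes l: "l \<in> set levels" and \<pi>: "1 \<le> length \<pi>" and eps_pos: "0 < \<epsilon>"
    and covered: "covered (length \<pi>) \<epsilon> l"
  shows "\<forall>\<^sub>F n in sequentially. \<bar>scale_density (level_scale l n) \<pi> (level_perm levels n) -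
    scale_density (model_scale l) \<pi> (model l)\<bar> \<le> 2 * \<epsilon>"
proof -
  let ?k = "length \<pi>"
  obtain coarser finer where levels: "levels = coarser @ l # finer" using split_list[OF l] by blast
  define W where "W n = scale_windows (level_scale l n) ?k n" for n
  obtain q where q: "\<forall>\<^sub>F n in sequentially.
     max (real ?k) (model_scale l) * real (level_block l n) \<le> max (real ?k) (level_scale l n) \<and>
     q n * length (model l) * level_block l n \<le> n \<and>
     (1 - \<epsilon>) * real (card (W n)) \<le>
       real (q n * card (scale_windows (model_scale l) ?k (length (model l))) * level_block l n ^ ?k)"
    using covered by (auto simp: covered_def W_def)
  have "\<forall>\<^sub>F n in sequentially. real (card (W n \<inter> crossing_any coarser n)) / real (card (W n)) < \<epsilon>"
    unfolding W_def by (rule order_tendstoD(2)[OF tendsto_coarse_crossing_ratio[OF levels \<pi>] eps_pos])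
  then show ?thesis
    using q eventually_level_block_pos[OF proper[OF l]] eventually_ge_at_top[of ?k]
  proof eventually_elim
    case (elim n)
    have W_pos: "0 < card (W n)" unfolding W_def using \<pi> elim by (intro card_windows_pos) auto
    have agree: "pat_at (level_perm levels n) I = pattern_on (inflation (level_block l n) (model l)) I"
      if "I \<in> W n" "I \<notin> crossing_any coarser n" "inj_on (inflation (level_block l n) (model l)) I" for I
      using pat_at_level_perm[OF levels, of I n] that by (simp add: W_def level_key_def windows_def)
    have few: "real (card (W n \<inter> crossing_any coarser n)) \<le> \<epsilon> * real (card (W n))"
      using elim(1) W_pos by (simp add: divide_less_eq)
    show ?case
      unfolding scale_density_def
      using elim W_pos agree few proper[OF l] \<pi>
      by (intro rho_inflation_approx[where b = "level_block l n" and q = "q n"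
            and X = "crossing_any coarser n"])
        (auto simp: proper_level_def W_def)
  qed
qed

lemma eventually_level_perm_approx:
  assumes l: "l \<in> set levels" and P: "finite P" "P \<subseteq> PermS" and eps_pos: "0 < \<epsilon>"
    and approx: "approximates P \<epsilon> \<Xi> l"
  shows "\<forall>\<^sub>F n in sequentially. \<forall>\<pi>\<in>P.
    \<bar>scale_density (level_scale l n) \<pi> (level_perm levels n) - \<Xi> \<pi>\<bar> \<le> 3 * \<epsilon>"
proof (intro eventually_ball_finite ballI P(1))
  fix \<pi> assume "\<pi> \<in> P"
  then have \<pi>: "1 \<le> length \<pi>" "covered (length \<pi>) \<epsilon> l"
    "\<bar>scale_density (model_scale l) \<pi> (model l) - \<Xi> \<pi>\<bar> \<le> \<epsilon>"
    using approx P(2) PermS_length by (auto simp: approximates_def)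
  show "\<forall>\<^sub>F n in sequentially. \<bar>scale_density (level_scale l n) \<pi> (level_perm levels n) - \<Xi> \<pi>\<bar> \<le> 3 * \<epsilon>"
    using eventually_level_perm_density[OF l \<pi>(1) eps_pos \<pi>(2)] by eventually_elim (use \<pi>(3) in linarith)
qed

end

subsection \<open>Simultaneous convergence\<close>

lemma ex_list_sorted_by_domination:
  fixes G :: "'i \<Rightarrow> nat \<Rightarrow> real"
  assumes A: "finite A" and G: "\<And>i. i \<in> A \<Longrightarrow> \<forall>\<^sub>F n in sequentially. 1 \<le> G i n"
    and total: "\<And>i j. i \<in> A \<Longrightarrow> j \<in> A \<Longrightarrow> i \<noteq> j \<Longrightarrow> dominated (G i) (G j) \<or> dominated (G j) (G i)"
  obtains xs where "set xs = A" "sorted_wrt (\<lambda>i j. dominated (G j) (G i)) xs"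
proof -
  have "\<forall>\<^sub>F n in sequentially. \<forall>i\<in>A. \<forall>j\<in>A. dominated (G i) (G j) \<longrightarrow> G i n < G j n"
    using A G eventually_less_if_dominated
    by (intro eventually_ball_finite ballI) (auto simp: eventually_mono)
  then obtain n where n: "\<And>i j. i \<in> A \<Longrightarrow> j \<in> A \<Longrightarrow> dominated (G i) (G j) \<Longrightarrow> G i n < G j n"
    using eventually_happens'[OF sequentially_bot] by blast
  have "inj_on (\<lambda>i. G i n) A" using n total by (intro inj_onI) (metis less_irrefl)
  then obtain e where e: "bij_betw e {0..<card A} A" "strict_mono_on {0..<card A} ((\<lambda>i. G i n) \<circ> e)"
    using ex_sorting_bij[OF A] by blast
  have "dominated (G (e i)) (G (e j))" if "i < j" "j < card A" for i j
  proof -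
    have "e i \<in> A" "e j \<in> A" "G (e i) n < G (e j) n"
      using that e bij_betwE[OF e(1)] by (auto simp: strict_mono_on_def)
    then show ?thesis using n[of "e j" "e i"] total[of "e i" "e j"] by force
  qed
  then have "sorted_wrt (\<lambda>i j. dominated (G i) (G j)) (map e [0..<card A])"
    by (simp add: sorted_wrt_iff_nth_less)
  then show ?thesis
    using e(1) by (intro that[of "rev (map e [0..<card A])"]) (simp_all add: sorted_wrt_rev bij_betw_def)
qed

lemma ex_perm_approximating_all:
  fixes G :: "nat \<Rightarrow> nat \<Rightarrow> real"
  assumes approx: "\<And>i. approximable (G i) (\<Xi> i)"
    and G_le: "\<And>i. \<forall>\<^sub>F n in sequentially. G i n \<le> real n"
    and total: "\<And>i j. i \<noteq> j \<Longrightarrow> dominated (G i) (G j) \<or> dominated (G j) (G i)"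
    and G_0: "G 0 = (\<lambda>_. 1)"
    and P: "finite P" "P \<subseteq> PermS" and eps_pos: "0 < \<epsilon>"
  shows "\<exists>\<tau>. is_perm \<tau> \<and> K \<le> length \<tau> \<and>
    (\<forall>i\<le>K. \<forall>\<pi>\<in>P. \<bar>scale_density (G i (length \<tau>)) \<pi> \<tau> - \<Xi> i \<pi>\<bar> \<le> 3 * \<epsilon>)"
proof -
  have "\<forall>i. \<exists>l. level_scale l = G i \<and> proper_level l \<and> approximates P \<epsilon> (\<Xi> i) l"
    using approx P eps_pos unfolding approximable_def by blast
  then obtain level where level: "\<And>i. level_scale (level i) = G i" "\<And>i. proper_level (level i)"
    "\<And>i. approximates P \<epsilon> (\<Xi> i) (level i)"
    by metis
  have "\<forall>\<^sub>F n in sequentially. 1 \<le> G i n" for i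
    using level(1,2)[of i] by (auto simp: proper_level_def elim: eventually_mono)
  then obtain xs where xs: "set xs = {..K}" "sorted_wrt (\<lambda>i j. dominated (G j) (G i)) xs"
    using ex_list_sorted_by_domination[of "{..K}" G] total by blast
  interpret level_hierarchy "map level xs"
    using level(2) G_le xs G_0 by unfold_locales (auto simp: level(1) sorted_wrt_map)
  have "\<forall>\<^sub>F n in sequentially. \<forall>i\<in>{..K}. \<forall>\<pi>\<in>P.
      \<bar>scale_density (G i n) \<pi> (level_perm (map level xs) n) - \<Xi> i \<pi>\<bar> \<le> 3 * \<epsilon>"
  proof (rule eventually_ball_finite[OF finite_atMost], rule ballI)
    fix i assume "i \<in> {..K}"
    then show "\<forall>\<^sub>F n in sequentially. \<forall>\<pi>\<in>P.
        \<bar>scale_density (G i n) \<pi> (level_perm (map level xs) n) - \<Xi> i \<pi>\<bar> \<le> 3 * \<epsilon>"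
      using eventually_level_perm_approx[OF _ P eps_pos level(3), of i] xs(1) by (simp add: level(1))
  qed
  from eventually_happens'[OF sequentially_bot eventually_conj[OF this eventually_ge_at_top[of K]]]
  obtain n where "K \<le> n" "\<forall>i\<in>{..K}. \<forall>\<pi>\<in>P.
      \<bar>scale_density (G i n) \<pi> (level_perm (map level xs) n) - \<Xi> i \<pi>\<bar> \<le> 3 * \<epsilon>"
    by blast
  then show ?thesis
    using is_perm_level_perm by (intro exI[of _ "level_perm (map level xs) n"]) auto
qed

lemma finite_PermS_length_le: "finite {\<pi> \<in> PermS. length \<pi> \<le> K}"
proof (rule finite_subset)
  show "{\<pi> \<in> PermS. length \<pi> \<le> K} \<subseteq> {\<pi>. set \<pi> \<subseteq> {0..<K} \<and> length \<pi> \<le> K}"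
    by (auto simp: PermS_def is_perm_def)
qed (simp add: finite_lists_length_le)

lemma ex_densities_converge_all:
  fixes G :: "nat \<Rightarrow> nat \<Rightarrow> real"
  assumes "\<And>i. approximable (G i) (\<Xi> i)"
    and "\<And>i. \<forall>\<^sub>F n in sequentially. G i n \<le> real n"
    and "\<And>i j. i \<noteq> j \<Longrightarrow> dominated (G i) (G j) \<or> dominated (G j) (G i)"
    and "G 0 = (\<lambda>_. 1)"
  shows "\<exists>\<tau>. perm_sequence \<tau> \<and> (\<forall>i. densities_converge (G i) \<tau> (\<Xi> i))"
proof -
  have "\<exists>\<tau>. is_perm \<tau> \<and> K \<le> length \<tau> \<and> (\<forall>i\<le>K. \<forall>\<pi>\<in>{\<pi> \<in> PermS. length \<pi> \<le> K}.
      \<bar>scale_density (G i (length \<tau>)) \<pi> \<tau> - \<Xi> i \<pi>\<bar> \<le> 3 * inverse (real (Suc K)))" for K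
    by (rule ex_perm_approximating_all) (use assms finite_PermS_length_le in auto)
  then obtain \<tau> where \<tau>: "\<And>K. is_perm (\<tau> K)" "\<And>K. K \<le> length (\<tau> K)"
    and close: "\<And>K i \<pi>. i \<le> K \<Longrightarrow> \<pi> \<in> PermS \<Longrightarrow> length \<pi> \<le> K \<Longrightarrow>
      \<bar>scale_density (G i (length (\<tau> K))) \<pi> (\<tau> K) - \<Xi> i \<pi>\<bar> \<le> 3 * inverse (real (Suc K))"
    by (metis (mono_tags, lifting) mem_Collect_eq)
  have "perm_sequence \<tau>"
    unfolding perm_sequence_def
    using \<tau> filterlim_at_top_mono[OF filterlim_ident, of "\<lambda>K. length (\<tau> K)"] by simp
  moreover have "densities_converge (G i) \<tau> (\<Xi> i)" for i
    unfolding densities_converge_def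
  proof
    fix \<pi> assume \<pi>: "\<pi> \<in> PermS"
    have "\<forall>\<^sub>F K in sequentially. norm (scale_density (G i (length (\<tau> K))) \<pi> (\<tau> K) - \<Xi> i \<pi>)
        \<le> 3 * inverse (real (Suc K))"
      using eventually_ge_at_top[of i] eventually_ge_at_top[of "length \<pi>"]
      by eventually_elim (simp add: close \<pi> del: of_nat_Suc)
    moreover have "(\<lambda>K. 3 * inverse (real (Suc K))) \<longlonglongrightarrow> 0"
      using tendsto_mult_right_zero[OF LIMSEQ_inverse_real_of_nat] by simp
    ultimately show "(\<lambda>K. scale_density (G i (length (\<tau> K))) \<pi> (\<tau> K)) \<longlonglongrightarrow> \<Xi> i \<pi>"
      by (rule LIM_zero_cancel[OF Lim_null_comparison])
  qed
  ultimately show ?thesis by blast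
qed

theorem mainTheorem9:
  fixes fs :: "nat \<Rightarrow> nat \<Rightarrow> real"
    and \<Xi> :: "nat \<Rightarrow> nat list \<Rightarrow> real"
    and \<Gamma> :: "(real \<times> real) measure"
    and \<Lambda> :: "nat list \<Rightarrow> real"
  assumes inj: "inj fs"
    and scaling: "\<And>t. scaling_function (fs t)"
    and total: "\<And>s t. s \<noteq> t \<Longrightarrow> dominated (fs s) (fs t) \<or> dominated (fs t) (fs s)"
    and scale_lim: "\<And>t. scale_limit (\<Xi> t)"
    and permuton: "permuton \<Gamma>"
    and local_lim: "perm_local_limit \<Lambda>"
  shows "\<exists>\<tau>. perm_sequence \<tau> \<and>
           (\<forall>t. converges_at_scale (fs t) \<tau> (\<Xi> t)) \<and>
           converges_globally \<tau> \<Gamma> \<and>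
           converges_locally \<tau> \<Lambda>"
proof -
  let ?G = "case_nat (\<lambda>_. 1) (case_nat real fs)"
  let ?\<Xi> = "case_nat \<Lambda> (case_nat (\<lambda>\<pi>. permuton_density \<pi> \<Gamma>) \<Xi>)"
  note fs = scaling_functionD[OF scaling]
  have const: "dominated (\<lambda>_. 1) real" "dominated (\<lambda>_. 1) (fs t)" for t
    by (intro dominated_const filterlim_real_sequentially fs)+
  have "\<exists>\<tau>. perm_sequence \<tau> \<and> (\<forall>i. densities_converge (?G i) \<tau> (?\<Xi> i))"
  proof (rule ex_densities_converge_all)
    show "approximable (?G i) (?\<Xi> i)" for i
      using approximable_local_limit[OF local_lim] approximable_permuton[OF permuton]
        approximable_scale_limit[OF scale_lim scaling] by (simp split: nat.split)
    show "\<forall>\<^sub>F n in sequentially. ?G i n \<le> real n" for i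
      using eventually_ge_at_top[of 1] fs(3)
      by (auto split: nat.split elim: eventually_mono)
    show "dominated (?G i) (?G j) \<or> dominated (?G j) (?G i)" if "i \<noteq> j" for i j
      using that total fs(2) const
      by (cases i; cases j) (auto split: nat.split)
  qed simp
  then obtain \<tau> where \<tau>: "perm_sequence \<tau>" and lim: "\<And>i. densities_converge (?G i) \<tau> (?\<Xi> i)" by blast
  have "converges_at_scale (fs t) \<tau> (\<Xi> t)" for t
    using lim[of "Suc (Suc t)"] by (simp add: converges_at_scale_iff[OF \<tau> fs(1)])
  moreover have "converges_globally \<tau> \<Gamma>" using lim[of 1] by (simp add: converges_globally_iff[OF \<tau>])
  moreover have "converges_locally \<tau> \<Lambda>" using lim[of 0] by (simp add: converges_locally_iff)
  ultimately show ?thesis using \<tau> by blast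
qed

end
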